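(* Let $a,b,c,\alpha,\beta,\gamma$ be integers with $0\le\alpha<a$, $0\le\beta<b$, $0\le\gamma<c$ and at most one of $\alpha,\beta,\gamma$ zero. Suppose $a+b+c+\alpha+\beta+\gamma\equiv 0\pmod 3$, put $s=\frac13(a+b+c+\alpha+\beta+\gamma)-2$, $A=s+2-a$, $B=s+2-b$, $C=s+2-c$, $M=s+2-(\alpha+\beta+\gamma)$, and assume $0\le M$, $0\le A\le\beta+\gamma$, $0\le B\le\alpha+\gamma$, $0\le C\le\alpha+\beta$. If $\gamma=0$, then $$|\det N_{a,b,c,\alpha,\beta,\gamma}|=\operatorname{Mac}(\beta-A,A,M)\,\operatorname{Mac}(\alpha-B,B,M)\,\frac{\mathcal H(A+M)\mathcal H(B+M)\mathcal H(C+M)\mathcal H(A+B+C+M)}{\mathcal H(a)\mathcal H(b)\mathcal H(c)\mathcal H(M)}.$$ Thus, for an infinite field $K$, the quotient of $K[x,y,z]$ by the type $2$ ideal $I_{a,b,c,\alpha,\beta,0}=(x^a,y^b,z^c,x^\alpha y^\beta)$ has the weak Lefschetz property if the characteristic of $K$ is zero or at least $A+B+C+M$.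
   Context: $\mathcal H(n):=\prod_{i=0}^{n-1}i!$ is the hyperfactorial, and for non-negative integers $\operatorname{Mac}(p,q,r):=\dfrac{\mathcal H(p)\mathcal H(q)\mathcal H(r)\mathcal H(p+q+r)}{\mathcal H(p+q)\mathcal H(p+r)\mathcal H(q+r)}$. $N_{a,b,c,\alpha,\beta,\gamma}$ is the $(C+M)\times(C+M)$ integer matrix with $(i,j)$ entry $\binom{c}{A+j-i}$ if $1\le i\le C$ and $\binom{\gamma}{A+C-\beta+j-i}$ if $C+1\le i\le C+M$, where $\binom nk=0$ if $k<0$ or $k>n$ (determinant of the empty matrix is $1$). "Type $2$" refers to the socle of the quotient algebra being $2$-dimensional (automatic here). An artinian standard graded $K$-algebra $Q$ has the weak Lefschetz property if there is a linear form $\ell\in[Q]_1$ such that for all integers $d$ the map $\times\ell:[Q]_d\to[Q]_{d+1}$ is injective or surjective. *)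

theory Defs
  imports
    "HOL-Library.Poly_Mapping"
    "HOL-Algebra.Algebraic_Closure_Type"
    "HOL-Algebra.QuotRing"
    "Jordan_Normal_Form.Determinant"
begin

definition hyperfactorial :: "nat \<Rightarrow> nat" where
  "hyperfactorial n = (\<Prod>i<n. fact i)"

definition Mac :: "nat \<Rightarrow> nat \<Rightarrow> nat \<Rightarrow> real" where
  "Mac p q r =
     real (hyperfactorial p * hyperfactorial q * hyperfactorial r * hyperfactorial (p + q + r)) /
     real (hyperfactorial (p + q) * hyperfactorial (p + r) * hyperfactorial (q + r))"

definition int_binom :: "int \<Rightarrow> int \<Rightarrow> int" where
  "int_binom n k = (if k < 0 \<or> k > n then 0 else int (nat n choose nat k))"

(* Matrix indices of the library start at 0; i and j below are the indices starting at 1. *)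
definition N_matrix :: "int \<Rightarrow> int \<Rightarrow> int \<Rightarrow> int \<Rightarrow> int \<Rightarrow> int \<Rightarrow> int mat" where
  "N_matrix a b c \<alpha> \<beta> \<gamma> =
     (let s = (a + b + c + \<alpha> + \<beta> + \<gamma>) div 3 - 2;
          A = s + 2 - a; C = s + 2 - c; M = s + 2 - (\<alpha> + \<beta> + \<gamma>)
      in mat (nat (C + M)) (nat (C + M))
           (\<lambda>(i0, j0). let i = int i0 + 1; j = int j0 + 1 in
              if i \<le> C then int_binom c (A + j - i)
              else int_binom \<gamma> (A + C - \<beta> + j - i)))"

datatype variable = Vx | Vy | Vz

(* K[x,y,z]: finitely supported maps from exponent vectors to coefficients, with convolution. *)
type_synonym 'k poly3 = "(variable \<Rightarrow>\<^sub>0 nat) \<Rightarrow>\<^sub>0 'k"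

definition var_power :: "variable \<Rightarrow> nat \<Rightarrow> 'k::field poly3" where
  "var_power v n = Poly_Mapping.single (Poly_Mapping.single v n) 1"

definition poly3_ring :: "'k::field poly3 ring" where
  "poly3_ring = ring_of_type_algebra"

definition monomial_degree :: "(variable \<Rightarrow>\<^sub>0 nat) \<Rightarrow> nat" where
  "monomial_degree m =
     Poly_Mapping.lookup m Vx + Poly_Mapping.lookup m Vy + Poly_Mapping.lookup m Vz"

(* The forms of degree d, including 0; for d < 0 this is {0}. *)
definition forms :: "int \<Rightarrow> 'k::field poly3 set" where
  "forms d = {f. \<forall>m \<in> Poly_Mapping.keys f. int (monomial_degree m) = d}"

definition graded_piece :: "'k::field poly3 set \<Rightarrow> int \<Rightarrow> 'k poly3 set set" where
  "graded_piece I d = (\<lambda>f. I +>\<^bsub>poly3_ring\<^esub> f) ` forms d"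

(* Weak Lefschetz property of the quotient of K[x,y,z] by I. It is meant for homogeneous ideals I
   with artinian quotient. *)
definition quotient_has_WLP :: "'k::field poly3 set \<Rightarrow> bool" where
  "quotient_has_WLP I \<longleftrightarrow>
     (\<exists>l \<in> graded_piece I 1. \<forall>d::int.
        inj_on (\<lambda>q. l \<otimes>\<^bsub>poly3_ring Quot I\<^esub> q) (graded_piece I d) \<or>
        (\<lambda>q. l \<otimes>\<^bsub>poly3_ring Quot I\<^esub> q) ` graded_piece I d = graded_piece I (d + 1))"

definition I_ideal ::
    "nat \<Rightarrow> nat \<Rightarrow> nat \<Rightarrow> nat \<Rightarrow> nat \<Rightarrow> nat \<Rightarrow> 'k::field poly3 set" where
  "I_ideal a b c \<alpha> \<beta> \<gamma> =
     Idl\<^bsub>poly3_ring\<^esub> {var_power Vx a, var_power Vy b, var_power Vz c,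
                     var_power Vx \<alpha> * var_power Vy \<beta> * var_power Vz \<gamma>}"

end

theory Submission
  imports Defs
begin

text \<open>Put \<open>p = \<alpha> - B\<close> and \<open>q = \<beta> - A\<close>. The definitions of \<open>A, B, C, M\<close> give \<open>C = p + q\<close>,
\<open>a = M + B + C\<close>, \<open>b = M + A + C\<close>, \<open>c = M + A + B\<close> and \<open>s + 2 = M + A + B + C\<close>, so everything
can be expressed by the natural numbers \<open>A, B, M, p, q\<close>.

For \<open>\<gamma> = 0\<close> the last \<open>M\<close> rows of \<open>N\<close> are unit vectors, with their ones in the \<open>M\<close> consecutive columns
that follow the first \<open>q\<close> columns (\<open>N_matrix_gamma_0\<close>). Laplace expansion removes these rows and columns
and leaves a \<open>C \<times> C\<close> matrix with entries \<open>c choose (y\<^sub>j - i)\<close>. For any nodes \<open>y\<^sub>j\<close> such a determinant is a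
product (\<open>det_binomial_columns\<close>): unimodular row operations raise the upper index of row \<open>i\<close> from \<open>c\<close> to
\<open>c + n - 1 - i\<close>, and then the entry is, up to a factor of the row and a factor of the column, the falling
factorial of \<open>y\<^sub>j\<close> of length \<open>i\<close>, so that a Vandermonde product of the nodes remains. Here the nodes
form two runs of consecutive numbers, of lengths \<open>q\<close> and \<open>p\<close> and separated by a gap of length \<open>M\<close>; for them
all the products are hyperfactorials.

For the weak Lefschetz property take \<open>\<ell> = x + y + z\<close>, and let \<open>T = K[x,y]/(x\<^sup>a, y\<^sup>b, x\<^sup>\<alpha> y\<^sup>\<beta>)\<close>. The quotient
is \<open>T[z]/(z\<^sup>c)\<close>. Since \<open>z = -(x + y)\<close> modulo \<open>\<ell>\<close>, both the kernel and the cokernel of \<open>\<times>\<ell>\<close> between the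
degrees \<open>s\<close> and \<open>s + 1\<close> are those of multiplication by \<open>(x + y)\<^sup>c\<close> from degree \<open>C - 1\<close> to degree \<open>s + 1\<close>
of \<open>T\<close>. In terms of the monomials of degree \<open>s + 1\<close> outside \<open>(x\<^sup>a, y\<^sup>b)\<close>, the first \<open>C\<close> rows of \<open>N\<close> are
the multiples of \<open>(x + y)\<^sup>c\<close> by the monomials of degree \<open>C - 1\<close> and the others are the multiples of
\<open>x\<^sup>\<alpha> y\<^sup>\<beta>\<close>. So \<open>\<times>\<ell>\<close> is bijective there as soon as \<open>det N\<close> is nonzero in \<open>K\<close> (\<open>kernel_peak\<close>,
\<open>binary_monomials_in_image_forms\<close>); the product formula yields this, because it only contains factorials
of numbers below \<open>A + B + C + M\<close>. Surjectivity passes to all higher degrees, as the ring is generated in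
degree one. Injectivity passes to all lower degrees, as the quotient has no socle below degree \<open>s\<close>
(\<open>kernel_below_peak\<close>).\<close>

section \<open>Determinants of falling factorials and of binomial coefficients\<close>

text \<open>Expanding along the last row, which is a unit vector, deletes the last of the \<open>M\<close> columns that carry the
ones; the remaining matrix has the same shape with \<open>M\<close> decreased by one.\<close>

lemma det_unit_row_block:
  fixes f :: "nat \<Rightarrow> nat \<Rightarrow> int"
  shows "\<bar>det (mat (q + p + M) (q + p + M)
            (\<lambda>(i, j). if i < q + p then f i j else if j + p = i then 1 else 0))\<bar> =
         \<bar>det (mat (q + p) (q + p) (\<lambda>(i, j). f i (if j < q then j else j + M)))\<bar>"
proof (induction M arbitrary: f)
  case 0
  have "mat (q + p + 0) (q + p + 0)
            (\<lambda>(i, j). if i < q + p then f i j else if j + p = i then 1 else 0) =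
        mat (q + p) (q + p) (\<lambda>(i, j). f i (if j < q then j else j + 0))"
    by (rule eq_matI) auto
  then show ?case by simp
next
  case (Suc M)
  let ?n = "q + p + Suc M"
  define W where "W = mat ?n ?n (\<lambda>(i, j). if i < q + p then f i j else if j + p = i then 1 else 0)"
  define g where "g i j = (if j < q + M then f i j else f i (Suc j))" for i j
  have W: "W \<in> carrier_mat ?n ?n" unfolding W_def by simp
  have "det W = (\<Sum>j<?n. W $$ (q + p + M, j) * cofactor W (q + p + M) j)"
    by (rule laplace_expansion_row[OF W]) simp
  also have "\<dots> = (\<Sum>j<?n. if j = q + M then cofactor W (q + p + M) j else 0)"
    by (rule sum.cong) (auto simp: W_def)
  also have "\<dots> = cofactor W (q + p + M) (q + M)" by simp
  finally have "\<bar>det W\<bar> = \<bar>det (mat_delete W (q + p + M) (q + M))\<bar>"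
    by (simp add: cofactor_def abs_mult power_abs)
  also have "mat_delete W (q + p + M) (q + M) =
      mat (q + p + M) (q + p + M) (\<lambda>(i, j). if i < q + p then g i j else if j + p = i then 1 else 0)"
    by (rule eq_matI) (auto simp: mat_delete_def W_def g_def)
  also have "\<bar>det \<dots>\<bar> = \<bar>det (mat (q + p) (q + p) (\<lambda>(i, j). g i (if j < q then j else j + M)))\<bar>"
    by (rule Suc.IH)
  also have "mat (q + p) (q + p) (\<lambda>(i, j). g i (if j < q then j else j + M)) =
    mat (q + p) (q + p) (\<lambda>(i, j). f i (if j < q then j else j + Suc M))"
    by (rule eq_matI) (auto simp: g_def)
  finally show ?case unfolding W_def .
qed

text \<open>A monic polynomial of degree \<open>i\<close> is a combination of the Newton polynomials for arbitrary nodes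
\<open>x\<^sub>0, x\<^sub>1, \<dots>\<close>, with coefficient one at the top. The coefficients satisfy a recursion, because multiplying
the Newton polynomial of degree \<open>k\<close> by \<open>t - i = (t - x\<^sub>k) + (x\<^sub>k - i)\<close> gives the next one plus a multiple of itself.\<close>

lemma falling_factorial_newton_expansion:
  fixes x :: "nat \<Rightarrow> 'a :: comm_ring_1"
  shows "\<exists>L. L i = 1 \<and> (\<forall>k>i. L k = 0) \<and>
     (\<forall>t. (\<Prod>k<i. t - of_nat k) = (\<Sum>k\<le>i. L k * (\<Prod>m<k. t - x m)))"
proof (induction i)
  case 0
  show ?case by (rule exI[of _ "\<lambda>k. if k = 0 then 1 else 0"]) auto
next
  case (Suc i)
  then obtain L where L: "L i = 1" "\<And>k. k > i \<Longrightarrow> L k = 0"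
    "\<And>t. (\<Prod>k<i. t - of_nat k) = (\<Sum>k\<le>i. L k * (\<Prod>m<k. t - x m))" by blast
  define L' where "L' k = (if k = 0 then 0 else L (k - 1)) + L k * (x k - of_nat i)" for k
  have "(\<Prod>k<Suc i. t - of_nat k) = (\<Sum>k\<le>Suc i. L' k * (\<Prod>m<k. t - x m))" for t
  proof -
    have "(\<Prod>k<Suc i. t - of_nat k) = (\<Sum>k\<le>i. L k * (\<Prod>m<k. t - x m)) * (t - of_nat i)"
      by (simp add: L(3))
    also have "\<dots> = (\<Sum>k\<le>i. L k * (\<Prod>m<Suc k. t - x m) + L k * (x k - of_nat i) * (\<Prod>m<k. t - x m))"
      unfolding sum_distrib_right by (rule sum.cong) (auto simp: algebra_simps)
    also have "\<dots> = (\<Sum>k\<le>i. L k * (\<Prod>m<Suc k. t - x m)) +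
                    (\<Sum>k\<le>i. L k * (x k - of_nat i) * (\<Prod>m<k. t - x m))"
      by (rule sum.distrib)
    also have "(\<Sum>k\<le>i. L k * (x k - of_nat i) * (\<Prod>m<k. t - x m)) =
               (\<Sum>k\<le>Suc i. L k * (x k - of_nat i) * (\<Prod>m<k. t - x m))"
      by (simp add: L(2))
    also have "(\<Sum>k\<le>i. L k * (\<Prod>m<Suc k. t - x m)) =
               (\<Sum>k\<le>Suc i. (if k = 0 then 0 else L (k - 1)) * (\<Prod>m<k. t - x m))"
      by (subst sum.atMost_Suc_shift) simp
    finally show ?thesis
      by (simp only: L'_def distrib_right sum.distrib)
  qed
  moreover have "L' (Suc i) = 1" "\<forall>k>Suc i. L' k = 0"
    using L(1,2) by (auto simp: L'_def)
  ultimately show ?case by blast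
qed

lemma prod_list_diag_mat:
  assumes "A \<in> carrier_mat n n"
  shows "prod_list (diag_mat A) = (\<Prod>i<n. A $$ (i, i))"
  using assms by (simp add: diag_mat_def prod_list_def flip: prod.list_conv_set_nth)
     (metis atLeast0LessThan prod.distinct_set_conv_list distinct_upt set_upt prod_list_def)

text \<open>In the Newton basis at the same nodes the evaluation matrix is triangular, and its diagonal entries are the
rows of the Vandermonde product.\<close>

lemma det_falling_factorial:
  fixes x :: "nat \<Rightarrow> 'a :: idom"
  shows "det (mat n n (\<lambda>(i, j). \<Prod>k<i. x j - of_nat k)) = (\<Prod>j<n. \<Prod>k<j. x j - x k)"
proof -
  obtain L where L: "\<And>i. L i i = 1" "\<And>i k. k > i \<Longrightarrow> L i k = 0"
    "\<And>i t. (\<Prod>k<i. t - of_nat k) = (\<Sum>k\<le>i. L i k * (\<Prod>m<k. t - x m))"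
    using falling_factorial_newton_expansion[of _ x] by metis
  define LL where "LL = mat n n (\<lambda>(i, k). L i k)"
  define V where "V = mat n n (\<lambda>(k, j). \<Prod>m<k. x j - x m)"
  have LLc: "LL \<in> carrier_mat n n" and Vc: "V \<in> carrier_mat n n" by (auto simp: LL_def V_def)
  have "mat n n (\<lambda>(i, j). \<Prod>k<i. x j - of_nat k) = LL * V"
  proof (rule eq_matI)
    fix i j assume "i < dim_row (LL * V)" "j < dim_col (LL * V)"
    then have ij: "i < n" "j < n" by (auto simp: LL_def V_def)
    have "(LL * V) $$ (i, j) = (\<Sum>k<n. L i k * (\<Prod>m<k. x j - x m))"
      using ij by (simp add: LL_def V_def scalar_prod_def atLeast0LessThan)
    also have "\<dots> = (\<Sum>k\<le>i. L i k * (\<Prod>m<k. x j - x m))"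
      using ij by (intro sum.mono_neutral_right) (auto simp: L(2))
    finally show "mat n n (\<lambda>(i, j). \<Prod>k<i. x j - of_nat k) $$ (i, j) = (LL * V) $$ (i, j)"
      using ij by (simp add: L(3))
  qed (auto simp: LL_def V_def)
  moreover have "det LL = 1"
    by (subst det_lower_triangular[OF _ LLc]) (auto simp: LL_def prod_list_diag_mat[OF LLc[unfolded LL_def]] L)
  moreover have "det V = (\<Prod>j<n. \<Prod>k<j. x j - x k)"
  proof -
    have "upper_triangular V"
      unfolding upper_triangular_def by (auto simp: V_def)
    then show ?thesis
      by (subst det_upper_triangular[OF _ Vc]) (auto simp: prod_list_diag_mat[OF Vc], auto simp: V_def)
  qed
  ultimately show ?thesis using det_mult[OF LLc Vc] by simp
qed

text \<open>The falling factorial of \<open>y\<close> agrees with a binomial coefficient up to a factor that depends on \<open>i\<close> only and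
one that depends on \<open>y\<close> only: \<open>(c + n - 1 - i) - (y - i)\<close> does not involve \<open>i\<close>.\<close>

lemma fact_mult_choose_shift:
  assumes "y < c + n" "i < n"
  shows "int (fact (c + n - 1 - i)) * (\<Prod>k<i. int y - int k) =
     int (if i \<le> y then (c + n - 1 - i) choose (y - i) else 0) * (int (fact y) * int (fact (c + n - 1 - y)))"
proof (cases "i \<le> y")
  case True
  have 1: "int (fact y) = int (fact (y - i)) * (\<Prod>k<i. int y - int k)"
    using True
  proof (induction i)
    case (Suc i)
    then have "y - i = Suc (y - Suc i)" "int y - int i = int (Suc (y - Suc i))" by simp_all
    then have "int (fact (y - i)) = (int y - int i) * int (fact (y - Suc i))"
      by (simp only: fact_Suc of_nat_mult of_nat_id)
    then show ?case using Suc by simp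
  qed simp
  have 2: "int (fact (c + n - 1 - i)) =
      int (fact (y - i)) * int (fact (c + n - 1 - y)) * int ((c + n - 1 - i) choose (y - i))"
  proof -
    have "fact (y - i) * fact (c + n - 1 - i - (y - i)) * ((c + n - 1 - i) choose (y - i)) = fact (c + n - 1 - i)"
      using assms True by (intro binomial_fact_lemma) auto
    moreover have "c + n - 1 - i - (y - i) = c + n - 1 - y" using True by simp
    ultimately show ?thesis by (metis of_nat_mult)
  qed
  show ?thesis unfolding 1 2 using True by simp
next
  case False
  then have "(\<Prod>k<i. int y - int k) = 0" by (intro prod_zero) (auto intro!: bexI[of _ y])
  then show ?thesis using False by simp
qed

text \<open>By the Vandermonde convolution, the unitriangular matrix with entries \<open>n - 1 - i choose (k - i)\<close> turns row
\<open>i\<close> of the binomial matrix into one with upper index \<open>c + n - 1 - i\<close>, which is a rescaled falling factorial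
matrix.\<close>

lemma det_binomial_columns:
  assumes "\<And>j. j < n \<Longrightarrow> y j < c + n"
  shows "det (mat n n (\<lambda>(i, j). int (if i \<le> y j then c choose (y j - i) else 0))) *
           (\<Prod>j<n. int (fact (y j)) * int (fact (c + n - 1 - y j))) =
         (\<Prod>i<n. int (fact (c + i))) * (\<Prod>j<n. \<Prod>k<j. int (y j) - int (y k))"
proof -
  define P where "P = mat n n (\<lambda>(i, j). int (if i \<le> y j then c choose (y j - i) else 0))"
  define U where "U = mat n n (\<lambda>(i, k). int (if i \<le> k then (n - 1 - i) choose (k - i) else 0))"
  define F where "F = mat n n (\<lambda>(i, j). \<Prod>k<i. int (y j) - of_nat k)"
  define D where "D = mat_diag n (\<lambda>i. int (fact (c + n - 1 - i)))"
  define E where "E = mat_diag n (\<lambda>j. int (fact (y j)) * int (fact (c + n - 1 - y j)))"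
  have carr: "P \<in> carrier_mat n n" "U \<in> carrier_mat n n" "F \<in> carrier_mat n n"
    "D \<in> carrier_mat n n" "E \<in> carrier_mat n n"
    by (auto simp: P_def U_def F_def D_def E_def)
  have UP: "(U * P) $$ (i, j) = int (if i \<le> y j then (c + n - 1 - i) choose (y j - i) else 0)"
    if ij: "i < n" "j < n" for i j
  proof -
    have "(U * P) $$ (i, j) = (\<Sum>k<n. int (if i \<le> k then (n - 1 - i) choose (k - i) else 0) *
        int (if k \<le> y j then c choose (y j - k) else 0))"
      using ij by (simp add: U_def P_def scalar_prod_def atLeast0LessThan)
    also have "\<dots> = (\<Sum>k\<in>{i..<n} \<inter> {i..y j}. int ((n - 1 - i choose (k - i)) * (c choose (y j - k))))"
      by (rule sum.mono_neutral_cong_right) auto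
    also have "\<dots> = int (\<Sum>k\<in>{i..<n} \<inter> {i..y j}. (n - 1 - i choose (k - i)) * (c choose (y j - k)))"
      by simp
    also have "(\<Sum>k\<in>{i..<n} \<inter> {i..y j}. (n - 1 - i choose (k - i)) * (c choose (y j - k))) =
       (\<Sum>k\<in>{i..y j}. (n - 1 - i choose (k - i)) * (c choose (y j - k)))"
    proof (rule sum.mono_neutral_left)
      show "\<forall>k\<in>{i..y j} - {i..<n} \<inter> {i..y j}. (n - 1 - i choose (k - i)) * (c choose (y j - k)) = 0"
      proof
        fix k assume "k \<in> {i..y j} - {i..<n} \<inter> {i..y j}"
        then have "n - 1 - i < k - i" using ij by auto
        then show "(n - 1 - i choose (k - i)) * (c choose (y j - k)) = 0" by (simp add: binomial_eq_0)
      qed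
    qed auto
    also have "\<dots> = (if i \<le> y j then (c + n - 1 - i) choose (y j - i) else 0)"
    proof (cases "i \<le> y j")
      case True
      then have "(\<Sum>k\<in>{i..y j}. (n - 1 - i choose (k - i)) * (c choose (y j - k))) =
         (\<Sum>k\<le>y j - i. (n - 1 - i choose k) * (c choose (y j - i - k)))"
        by (intro sum.reindex_bij_witness[of _ "\<lambda>k. k + i" "\<lambda>k. k - i"]) auto
      also have "\<dots> = (n - 1 - i + c) choose (y j - i)" by (rule vandermonde)
      also have "n - 1 - i + c = c + n - 1 - i" using ij by simp
      finally show ?thesis using True by simp
    qed simp
    finally show ?thesis .
  qed
  have "D * F = U * P * E"
    unfolding D_def E_def mat_diag_mult_left[OF carr(3)]
      mat_diag_mult_right[OF mult_carrier_mat[OF carr(2) carr(1)]]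
    using fact_mult_choose_shift[OF assms] by (intro eq_matI) (simp_all add: UP F_def)
  then have "det D * det F = det U * det P * det E"
    using det_mult[OF carr(4) carr(3)] det_mult[OF mult_carrier_mat[OF carr(2) carr(1)] carr(5)]
      det_mult[OF carr(2) carr(1)] by simp
  moreover have "det U = 1"
  proof -
    have "upper_triangular U" unfolding upper_triangular_def by (auto simp: U_def)
    then show ?thesis
      by (subst det_upper_triangular[OF _ carr(2)]) (auto simp: prod_list_diag_mat[OF carr(2)], auto simp: U_def)
  qed
  moreover have "det E = (\<Prod>j<n. int (fact (y j)) * int (fact (c + n - 1 - y j)))"
    by (subst det_lower_triangular[OF _ carr(5)]) (auto simp: prod_list_diag_mat[OF carr(5)], auto simp: E_def mat_diag_def)
  moreover have "det D = (\<Prod>i<n. int (fact (c + i)))"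
  proof -
    have "det D = (\<Prod>i<n. int (fact (c + n - 1 - i)))"
      by (subst det_lower_triangular[OF _ carr(4)]) (auto simp: prod_list_diag_mat[OF carr(4)], auto simp: D_def mat_diag_def)
    also have "\<dots> = (\<Prod>i<n. int (fact (c + i)))"
      by (rule prod.reindex_bij_witness[of _ "\<lambda>i. n - 1 - i" "\<lambda>i. n - 1 - i"]) auto
    finally show ?thesis .
  qed
  moreover have "det F = (\<Prod>j<n. \<Prod>k<j. int (y j) - int (y k))"
    unfolding F_def by (rule det_falling_factorial)
  ultimately show ?thesis unfolding P_def by simp
qed

section \<open>Hyperfactorials\<close>

lemma prod_lessThan_add:
  fixes f :: "nat \<Rightarrow> 'a :: comm_monoid_mult"
  shows "(\<Prod>j<m + n. f j) = (\<Prod>j<m. f j) * (\<Prod>j<n. f (m + j))"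
  by (induction n) (simp_all add: mult.assoc)

lemma hyperfactorial_add: "hyperfactorial (m + n) = hyperfactorial m * (\<Prod>i<n. fact (m + i))"
  by (simp add: hyperfactorial_def prod_lessThan_add)

lemma hyperfactorial_pos: "0 < hyperfactorial n"
  by (simp add: hyperfactorial_def prod_pos)

lemma prod_fact_rev: "(\<Prod>j<n. fact (m + n - 1 - j)) * hyperfactorial m = hyperfactorial (m + n)"
proof -
  have "(\<Prod>j<n. fact (m + n - 1 - j) :: nat) = (\<Prod>j<n. fact (m + (n - Suc j)))"
    by (rule prod.cong) auto
  also have "\<dots> = (\<Prod>j<n. fact (m + j))" by (rule prod.nat_diff_reindex)
  finally show ?thesis by (simp add: hyperfactorial_add)
qed

lemma prod_consecutive_below: "(\<Prod>k<n. int (m + n) - int k) * int (fact m) = int (fact (m + n))"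
proof (induction n)
  case (Suc n)
  have "(\<Prod>k<Suc n. int (m + Suc n) - int k) = int (m + Suc n) * (\<Prod>k<n. int (m + n) - int k)"
    by (subst prod.lessThan_Suc_shift) (simp add: algebra_simps)
  then have "(\<Prod>k<Suc n. int (m + Suc n) - int k) * int (fact m) = int (m + Suc n) * int (fact (m + n))"
    by (simp only: mult.assoc Suc)
  also have "\<dots> = int (fact (m + Suc n))"
    by (simp only: add_Suc_right fact_Suc of_nat_mult of_nat_id)
  finally show ?case .
qed simp

text \<open>Differences within a run of consecutive nodes give factorials. The node number \<open>r\<close> of the second run differs
from those of the first run by \<open>M + r + 1, \<dots>, M + r + q\<close>.\<close>

lemma vandermonde_two_blocks:
  fixes A M q p :: nat
  defines "y \<equiv> \<lambda>j. A + (if j < q then j else j + M)"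
  shows "(\<Prod>j<q + p. \<Prod>k<j. int (y j) - int (y k)) * int (hyperfactorial (M + p) * hyperfactorial (M + q)) =
     int (hyperfactorial q * hyperfactorial p * hyperfactorial (M + p + q) * hyperfactorial M)"
proof -
  have 1: "(\<Prod>k<j. int (y j) - int (y k)) = int (fact j)" if "j < q" for j
    using prod_consecutive_below[where m = 0 and n = j] that by (simp add: y_def)
  have 2: "(\<Prod>k<q + r. int (y (q + r)) - int (y k)) * int (fact (M + r)) = int (fact (M + q + r)) * int (fact r)" for r
  proof -
    have "(\<Prod>k<q + r. int (y (q + r)) - int (y k)) =
      (\<Prod>k<q. int (M + r + q) - int k) * (\<Prod>k<r. int (0 + r) - int k)"
      unfolding prod_lessThan_add by (simp add: y_def algebra_simps)
    then show ?thesis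
      using prod_consecutive_below[where m = "M + r" and n = q] prod_consecutive_below[where m = 0 and n = r] by (simp add: mult_ac add_ac)
  qed
  have "(\<Prod>j<q + p. \<Prod>k<j. int (y j) - int (y k)) * (\<Prod>r<p. int (fact (M + r))) =
     (\<Prod>j<q. int (fact j)) * (\<Prod>r<p. int (fact (M + q + r)) * int (fact r))"
    unfolding prod_lessThan_add[where f = "\<lambda>j. \<Prod>k<j. int (y j) - int (y k)"] mult.assoc
      prod.distrib[symmetric] 2 by (simp add: 1)
  also have "\<dots> = int (hyperfactorial q * hyperfactorial p * (\<Prod>r<p. fact (M + q + r)))"
    by (simp add: prod.distrib hyperfactorial_def)
  finally have 3: "(\<Prod>j<q + p. \<Prod>k<j. int (y j) - int (y k)) * int (\<Prod>r<p. fact (M + r)) = \<dots>"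
    by simp
  have 4: "hyperfactorial (M + p + q) = hyperfactorial (M + q) * (\<Prod>r<p. fact (M + q + r))"
    using hyperfactorial_add[of "M + q" p] by (simp add: add_ac)
  show ?thesis unfolding 4 hyperfactorial_add[of M p]
    using 3 by (simp add: mult_ac)
qed

lemma det_binomial_two_blocks:
  fixes A B M q p :: nat
  defines "P \<equiv> mat (q + p) (q + p) (\<lambda>(i, j). let y = A + (if j < q then j else j + M)
       in int (if i \<le> y then (M + A + B) choose (y - i) else 0))"
  shows "\<bar>det P\<bar> * int (hyperfactorial (A + q) * hyperfactorial (A + M + q + p) * hyperfactorial (M + B + q + p)
        * hyperfactorial (B + p) * hyperfactorial (M + A + B) * hyperfactorial (M + p) * hyperfactorial (M + q)) =
     int (hyperfactorial A * hyperfactorial (A + M + q) * hyperfactorial (M + B + p) * hyperfactorial B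
        * hyperfactorial (M + A + B + q + p) * hyperfactorial q * hyperfactorial p
        * hyperfactorial (M + p + q) * hyperfactorial M)"
proof -
  define y where "y j = A + (if j < q then j else j + M)" for j
  define c where "c = M + A + B"
  define Y where "Y = (\<Prod>j<q + p. fact (y j) :: nat)"
  define Z where "Z = (\<Prod>j<q + p. fact (c + (q + p) - 1 - y j) :: nat)"
  define W where "W = (\<Prod>i<q + p. fact (c + i) :: nat)"
  define V where "V = (\<Prod>j<q + p. \<Prod>k<j. int (y j) - int (y k))"
  have "V \<ge> 0"
    unfolding V_def by (intro prod_nonneg) (auto simp: y_def)
  have "det P * (int Y * int Z) = int W * V"
  proof -
    have "y j < c + (q + p)" if "j < q + p" for j
      using that by (auto simp: y_def c_def)
    moreover have "P = mat (q + p) (q + p) (\<lambda>(i, j). int (if i \<le> y j then c choose (y j - i) else 0))"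
      unfolding P_def y_def c_def Let_def ..
    ultimately show ?thesis
      using det_binomial_columns[of "q + p" y c]
      by (simp add: W_def Y_def Z_def V_def prod.distrib)
  qed
  then have "\<bar>det P * (int Y * int Z)\<bar> = \<bar>int W * V\<bar>" by simp
  then have main: "\<bar>det P\<bar> * (int Y * int Z) = int W * V"
    using \<open>V \<ge> 0\<close> by (simp add: abs_mult)
  have Y: "Y * (hyperfactorial A * hyperfactorial (A + M + q)) = hyperfactorial (A + q) * hyperfactorial (A + M + q + p)"
    unfolding Y_def y_def prod_lessThan_add hyperfactorial_add[of "A + M + q" p] hyperfactorial_add[of A q]
    by (simp add: add_ac mult_ac)
  have Z: "Z * (hyperfactorial (M + B + p) * hyperfactorial B) = hyperfactorial (M + B + q + p) * hyperfactorial (B + p)"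
  proof -
    have "Z = (\<Prod>j<q. fact (M + B + p + q - 1 - j)) * (\<Prod>j<p. fact (B + p - 1 - j))"
      unfolding Z_def y_def c_def prod_lessThan_add
      by (intro arg_cong2[where f = "(*)"] prod.cong refl) (auto intro!: arg_cong[where f = fact])
    then have "Z * (hyperfactorial (M + B + p) * hyperfactorial B) =
      ((\<Prod>j<q. fact (M + B + p + q - 1 - j)) * hyperfactorial (M + B + p)) *
      ((\<Prod>j<p. fact (B + p - 1 - j)) * hyperfactorial B)"
      by (simp only: ac_simps)
    also have "\<dots> = hyperfactorial (M + B + p + q) * hyperfactorial (B + p)"
      by (simp only: prod_fact_rev)
    also have "M + B + p + q = M + B + q + p" by simp
    finally show ?thesis .
  qed
  have W: "W * hyperfactorial c = hyperfactorial (M + A + B + q + p)"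
    using hyperfactorial_add[of c "q + p"] by (simp add: W_def c_def add_ac mult.commute)
  have V: "V * int (hyperfactorial (M + p) * hyperfactorial (M + q)) =
     int (hyperfactorial q * hyperfactorial p * hyperfactorial (M + p + q) * hyperfactorial M)"
    unfolding V_def y_def by (rule vandermonde_two_blocks)
  let ?H = "\<lambda>n. int (hyperfactorial n)"
  have "\<bar>det P\<bar> * int (hyperfactorial (A + q) * hyperfactorial (A + M + q + p) * hyperfactorial (M + B + q + p)
        * hyperfactorial (B + p) * hyperfactorial (M + A + B) * hyperfactorial (M + p) * hyperfactorial (M + q)) =
     \<bar>det P\<bar> * (int (hyperfactorial (A + q) * hyperfactorial (A + M + q + p)) * int (hyperfactorial (M + B + q + p)
        * hyperfactorial (B + p)) * ?H c * ?H (M + p) * ?H (M + q))"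
    by (simp add: c_def)
  also have "\<dots> = (\<bar>det P\<bar> * (int Y * int Z)) * (?H A * ?H (A + M + q) * ?H (M + B + p) * ?H B * ?H c * ?H (M + p) * ?H (M + q))"
    unfolding Y[symmetric] Z[symmetric] by (simp add: mult_ac)
  also have "\<dots> = int (W * hyperfactorial c) * (V * int (hyperfactorial (M + p) * hyperfactorial (M + q))) *
      (?H A * ?H (A + M + q) * ?H (M + B + p) * ?H B)"
    unfolding main by (simp add: mult_ac)
  finally show ?thesis unfolding W V by (simp add: mult_ac)
qed

section \<open>The determinant of N\<close>

lemma N_matrix_gamma_0:
  fixes A B M p q :: nat
  shows "N_matrix (int (M + B + q + p)) (int (M + A + q + p)) (int (M + A + B)) (int (B + p)) (int (A + q)) 0 =
    mat (q + p + M) (q + p + M) (\<lambda>(i, j). if i < q + p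
       then int (if i \<le> A + j then (M + A + B) choose (A + j - i) else 0)
       else if j + p = i then 1 else 0)"
proof -
  have s: "(int (M + B + q + p) + int (M + A + q + p) + int (M + A + B) + int (B + p) + int (A + q) + 0) div 3 - 2
     = int (M + A + B + q + p) - 2" by simp
  have bin: "int_binom (int c) k = (if 0 \<le> k then int (c choose nat k) else 0)" for c k
    by (auto simp: int_binom_def binomial_eq_0)
  have bin0: "int_binom 0 k = (if k = 0 then 1 else 0)" for k
    using bin[of 0] by (auto simp: int_binom_def)
  show ?thesis unfolding N_matrix_def Let_def s bin bin0
  proof (intro eq_matI, goal_cases)
    case (1 i j)
    then have ij: "i < q + p + M" "j < q + p + M" by auto
    have "int A + (int j + 1) - (int i + 1) = int (A + j) - int i" by simp
    moreover have "nat (int (A + j) - int i) = A + j - i" by simp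
    ultimately show ?case using ij by (auto simp: nat_diff_distrib' algebra_simps nat_int_add)
  qed (auto simp: nat_int_add)
qed

text \<open>Free of divisions, this form of the formula can be mapped into a field of any characteristic, where it decides
whether the determinant vanishes.\<close>

lemma abs_det_N_matrix_hyperfactorial:
  fixes A B M p q :: nat
  shows "\<bar>det (N_matrix (int (M + B + q + p)) (int (M + A + q + p)) (int (M + A + B)) (int (B + p)) (int (A + q)) 0)\<bar>
     * int (hyperfactorial (A + q) * hyperfactorial (A + M + q + p) * hyperfactorial (M + B + q + p)
        * hyperfactorial (B + p) * hyperfactorial (M + A + B) * hyperfactorial (M + p) * hyperfactorial (M + q)) =
     int (hyperfactorial A * hyperfactorial (A + M + q) * hyperfactorial (M + B + p) * hyperfactorial B
        * hyperfactorial (M + A + B + q + p) * hyperfactorial q * hyperfactorial p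
        * hyperfactorial (M + p + q) * hyperfactorial M)"
  unfolding N_matrix_gamma_0 det_unit_row_block det_binomial_two_blocks[symmetric]
  by (simp add: Let_def)

lemma abs_det_N_matrix_Mac:
  fixes A B M p q :: nat
  shows "real_of_int \<bar>det (N_matrix (int (M + B + q + p)) (int (M + A + q + p)) (int (M + A + B)) (int (B + p)) (int (A + q)) 0)\<bar>
     = Mac q A M * Mac p B M * real (hyperfactorial (A + M) * hyperfactorial (B + M) * hyperfactorial (q + p + M) * hyperfactorial (A + B + (q + p) + M))
       / real (hyperfactorial (M + B + q + p) * hyperfactorial (M + A + q + p) * hyperfactorial (M + A + B) * hyperfactorial M)"
proof -
  have pos: "hyperfactorial n \<noteq> 0" for n using hyperfactorial_pos[of n] by simp
  define d where "d = real_of_int \<bar>det (N_matrix (int (M + B + q + p)) (int (M + A + q + p)) (int (M + A + B)) (int (B + p)) (int (A + q)) 0)\<bar>"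
  let ?H = "\<lambda>n. real (hyperfactorial n)"
  have "d * (?H (A + q) * ?H (A + M + q + p) * ?H (M + B + q + p) * ?H (B + p) * ?H (M + A + B) * ?H (M + p) * ?H (M + q)) =
     ?H A * ?H (A + M + q) * ?H (M + B + p) * ?H B * ?H (M + A + B + q + p) * ?H q * ?H p * ?H (M + p + q) * ?H M"
    using arg_cong[OF abs_det_N_matrix_hyperfactorial[of M B q p A], of real_of_int] by (simp add: d_def)
  then have "d = ?H A * ?H (A + M + q) * ?H (M + B + p) * ?H B * ?H (M + A + B + q + p) * ?H q * ?H p * ?H (M + p + q) * ?H M
      / (?H (A + q) * ?H (A + M + q + p) * ?H (M + B + q + p) * ?H (B + p) * ?H (M + A + B) * ?H (M + p) * ?H (M + q))"
    by (subst eq_divide_eq) (simp add: pos)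
  also have "\<dots> = Mac q A M * Mac p B M * real (hyperfactorial (A + M) * hyperfactorial (B + M) * hyperfactorial (q + p + M) * hyperfactorial (A + B + (q + p) + M))
       / real (hyperfactorial (M + B + q + p) * hyperfactorial (M + A + q + p) * hyperfactorial (M + A + B) * hyperfactorial M)"
    unfolding Mac_def by (simp add: divide_simps pos) (simp add: ac_simps)
  finally show ?thesis unfolding d_def .
qed

lemma of_nat_fact_nonzero:
  assumes "CHAR('k::field) = 0 \<or> n < CHAR('k)"
  shows "of_nat (fact n) \<noteq> (0 :: 'k)"
proof (cases "CHAR('k) = 0")
  case True
  then show ?thesis by (simp add: of_nat_eq_0_iff_char_dvd)
next
  case False
  then have "prime CHAR('k)" by (intro prime_CHAR_semidom) simp
  then have "\<not> CHAR('k) dvd fact n" using assms False by (simp add: prime_dvd_fact_iff)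
  then show ?thesis by (simp add: of_nat_eq_0_iff_char_dvd)
qed

lemma of_nat_hyperfactorial_nonzero:
  assumes "CHAR('k::field) = 0 \<or> n \<le> CHAR('k)"
  shows "of_nat (hyperfactorial n) \<noteq> (0 :: 'k)"
  using assms of_nat_fact_nonzero[where 'k = 'k]
  by (force simp: hyperfactorial_def of_nat_prod simp del: of_nat_fact)

text \<open>The right-hand side of the integral formula is a product of factorials of numbers smaller than
\<open>M + A + B + q + p\<close>. No prime factor of these reaches the characteristic, so the right-hand side is nonzero
in the field, and with it the determinant.\<close>

lemma det_N_matrix_nonzero:
  fixes A B M p q :: nat
  assumes "CHAR('k::field) = 0 \<or> M + A + B + q + p \<le> CHAR('k)"
  shows "of_int (det (N_matrix (int (M + B + q + p)) (int (M + A + q + p)) (int (M + A + B)) (int (B + p)) (int (A + q)) 0)) \<noteq> (0 :: 'k)"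
    (is "of_int ?d \<noteq> _")
proof
  assume "of_int ?d = (0 :: 'k)"
  then have 0: "of_int \<bar>?d\<bar> = (0 :: 'k)" by (simp add: abs_if)
  have nz: "of_nat (hyperfactorial n) \<noteq> (0 :: 'k)" if "n \<le> M + A + B + q + p" for n
    using assms that by (intro of_nat_hyperfactorial_nonzero) auto
  show False
    using arg_cong[OF abs_det_N_matrix_hyperfactorial[of M B q p A], of "of_int :: int \<Rightarrow> 'k"] 0
    by (simp add: nz)
qed

section \<open>Forms, monomial ideals and coefficients\<close>

lemma poly3_ring_simps [simp]:
  "carrier poly3_ring = UNIV" "x \<otimes>\<^bsub>poly3_ring\<^esub> y = x * y" "x \<oplus>\<^bsub>poly3_ring\<^esub> y = x + y"
  "\<zero>\<^bsub>poly3_ring\<^esub> = 0" "\<one>\<^bsub>poly3_ring\<^esub> = 1"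
  by (simp_all add: poly3_ring_def ring_of_type_algebra_def)

lemma ring_poly3_ring: "ring poly3_ring"
  unfolding poly3_ring_def by (rule ring_from_type_algebra)

interpretation poly3: ring poly3_ring by (rule ring_poly3_ring)

lemma a_inv_poly3_ring [simp]: "\<ominus>\<^bsub>poly3_ring\<^esub> x = - x"
  by (rule poly3.minus_equality) simp_all

lemma a_minus_poly3_ring [simp]: "x \<ominus>\<^bsub>poly3_ring\<^esub> y = x - y"
  by (simp add: a_minus_def)

lemma ideal_poly3_ringI:
  assumes "0 \<in> I" "\<And>f g. f \<in> I \<Longrightarrow> g \<in> I \<Longrightarrow> f + g \<in> I" "\<And>f g. f \<in> I \<Longrightarrow> g * f \<in> I"
  shows "ideal I poly3_ring"
proof (rule idealI[OF ring_poly3_ring])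
  have "- f \<in> I" if "f \<in> I" for f using assms(3)[OF that, of "-1"] by simp
  then show "subgroup I (add_monoid poly3_ring)"
    by (intro poly3.add.subgroupI) (use assms in \<open>auto simp flip: a_inv_def\<close>)
qed (use assms(3) in \<open>auto simp: mult.commute\<close>)

lemma forms_add: "f \<in> forms d \<Longrightarrow> g \<in> forms d \<Longrightarrow> f + g \<in> forms d"
  using keys_add[of f g] by (force simp: forms_def)

lemma forms_uminus: "f \<in> forms d \<Longrightarrow> - f \<in> forms d"
  by (simp add: forms_def in_keys_iff)

lemma forms_diff: "f \<in> forms d \<Longrightarrow> g \<in> forms d \<Longrightarrow> f - g \<in> forms d"
  using forms_add[of f d "- g"] forms_uminus[of g d] by simp

lemma forms_0: "0 \<in> forms d"
  by (simp add: forms_def)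

lemma monomial_degree_add: "monomial_degree (m + n) = monomial_degree m + monomial_degree n"
  by (simp add: monomial_degree_def lookup_add)

lemma forms_mult: "f \<in> forms d \<Longrightarrow> g \<in> forms e \<Longrightarrow> f * g \<in> forms (d + e)"
  using keys_mult[of f g] by (force simp: forms_def monomial_degree_add)

text \<open>Translates the maps between cosets into membership statements about forms, so that no quotient is mentioned
any more.\<close>

lemma quotient_has_WLPI:
  assumes I: "ideal I poly3_ring" and l: "l \<in> forms 1"
    and inj_or_surj: "\<And>d. (\<forall>f\<in>forms d. l * f \<in> I \<longrightarrow> f \<in> I) \<or>
           (\<forall>g\<in>forms (d + 1). \<exists>f\<in>forms d. g - l * f \<in> I)"
  shows "quotient_has_WLP I"
proof -
  interpret I: ideal I poly3_ring by (rule I)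
  let ?C = "\<lambda>f. I +>\<^bsub>poly3_ring\<^esub> f"
  have eq: "?C f = ?C g \<longleftrightarrow> f - g \<in> I" for f g
    using poly3.quotient_eq_iff_same_a_r_cos[OF I, of f g] by simp
  have mult: "?C f \<otimes>\<^bsub>poly3_ring Quot I\<^esub> ?C g = ?C (f * g)" for f g
    using I.rcoset_mult_add[of f g] by (simp add: FactRing_def)
  have lf: "l * f \<in> forms (d + 1)" if "f \<in> forms d" for f d
    using forms_mult[OF l that] by (simp add: add.commute)
  show ?thesis unfolding quotient_has_WLP_def
  proof (intro bexI[of _ "?C l"] allI)
    fix d
    consider "\<forall>f\<in>forms d. l * f \<in> I \<longrightarrow> f \<in> I"
      | "\<forall>g\<in>forms (d + 1). \<exists>f\<in>forms d. g - l * f \<in> I" using inj_or_surj by blast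
    then show "inj_on (\<lambda>q. ?C l \<otimes>\<^bsub>poly3_ring Quot I\<^esub> q) (graded_piece I d) \<or>
      (\<lambda>q. ?C l \<otimes>\<^bsub>poly3_ring Quot I\<^esub> q) ` graded_piece I d = graded_piece I (d + 1)"
    proof cases
      case 1
      then have "inj_on (\<lambda>q. ?C l \<otimes>\<^bsub>poly3_ring Quot I\<^esub> q) (graded_piece I d)"
        by (auto simp: graded_piece_def inj_on_def mult eq forms_diff simp flip: right_diff_distrib)
      then show ?thesis ..
    next
      case 2
      have "(\<lambda>q. ?C l \<otimes>\<^bsub>poly3_ring Quot I\<^esub> q) ` graded_piece I d = (\<lambda>f. ?C (l * f)) ` forms d"
        by (auto simp: graded_piece_def mult image_image)
      also have "\<dots> = ?C ` forms (d + 1)"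
      proof (intro equalityI subsetI)
        fix x assume "x \<in> ?C ` forms (d + 1)"
        then obtain g where "x = ?C g" "g \<in> forms (d + 1)" by blast
        moreover from this(2) 2 obtain f where "f \<in> forms d" "g - l * f \<in> I" by blast
        ultimately show "x \<in> (\<lambda>f. ?C (l * f)) ` forms d" using eq by blast
      qed (use lf in blast)
      finally show ?thesis by (simp add: graded_piece_def)
    qed
  next
    show "?C l \<in> graded_piece I 1" using l by (auto simp: graded_piece_def)
  qed
qed

definition in_monomial_ideal :: "nat \<Rightarrow> nat \<Rightarrow> nat \<Rightarrow> nat \<Rightarrow> nat \<Rightarrow> nat \<Rightarrow> (variable \<Rightarrow>\<^sub>0 nat) \<Rightarrow> bool" where
  "in_monomial_ideal a b c \<alpha> \<beta> \<gamma> m \<longleftrightarrow>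
     a \<le> Poly_Mapping.lookup m Vx \<or> b \<le> Poly_Mapping.lookup m Vy \<or> c \<le> Poly_Mapping.lookup m Vz \<or>
     (\<alpha> \<le> Poly_Mapping.lookup m Vx \<and> \<beta> \<le> Poly_Mapping.lookup m Vy \<and> \<gamma> \<le> Poly_Mapping.lookup m Vz)"

lemma exponent_le_imp_add:
  fixes m n :: "variable \<Rightarrow>\<^sub>0 nat"
  assumes "\<And>v. Poly_Mapping.lookup m v \<le> Poly_Mapping.lookup n v"
  shows "n = (n - m) + m"
  by (rule poly_mapping_eqI) (use assms in \<open>simp add: lookup_add lookup_minus\<close>)

lemma update_eq_add_single:
  assumes "m \<notin> Poly_Mapping.keys f"
  shows "Poly_Mapping.update m c f = f + Poly_Mapping.single m c"
  by (rule poly_mapping_eqI)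
     (use assms in \<open>auto simp: lookup_update lookup_add lookup_single in_keys_iff when_def\<close>)

text \<open>Membership in a monomial ideal is a condition on the support: each monomial in the support is a multiple of
one of the generators.\<close>

lemma I_ideal_eq:
  "(I_ideal a b c \<alpha> \<beta> \<gamma> :: 'k::field poly3 set) =
     {f. \<forall>m\<in>Poly_Mapping.keys f. in_monomial_ideal a b c \<alpha> \<beta> \<gamma> m}"
proof -
  let ?P = "in_monomial_ideal a b c \<alpha> \<beta> \<gamma>"
  let ?J = "{f. \<forall>m\<in>Poly_Mapping.keys f. ?P m} :: 'k poly3 set"
  let ?G = "{var_power Vx a, var_power Vy b, var_power Vz c,
     var_power Vx \<alpha> * var_power Vy \<beta> * var_power Vz \<gamma>} :: 'k poly3 set"
  have P_add: "?P (m + n)" if "?P n" for m n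
    using that by (auto simp: in_monomial_ideal_def lookup_add)
  have "ideal ?J poly3_ring"
  proof (rule ideal_poly3_ringI)
    show "f + g \<in> ?J" if "f \<in> ?J" "g \<in> ?J" for f g using that keys_add[of f g] by blast
    show "g * f \<in> ?J" if "f \<in> ?J" for f g using that keys_mult[of g f] P_add by blast
  qed simp
  moreover have "?G \<subseteq> ?J"
    by (auto simp: var_power_def mult_single in_monomial_ideal_def lookup_add)
  ultimately have "I_ideal a b c \<alpha> \<beta> \<gamma> \<subseteq> ?J"
    unfolding I_ideal_def by (rule poly3.genideal_minimal)
  moreover have "f \<in> I_ideal a b c \<alpha> \<beta> \<gamma>" if "f \<in> ?J" for f
    using that
  proof (induction f rule: update_induct)
    interpret I: ideal "I_ideal a b c \<alpha> \<beta> \<gamma> :: 'k poly3 set" poly3_ring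
      unfolding I_ideal_def by (rule poly3.genideal_ideal) simp
    {
      case const
      show ?case using I.zero_closed by simp
    next
      case (update f m k)
      have gen: "g \<in> I_ideal a b c \<alpha> \<beta> \<gamma>" if "g \<in> ?G" for g
        using poly3.genideal_self[of ?G] that unfolding I_ideal_def by auto
      have single: "Poly_Mapping.single m k \<in> I_ideal a b c \<alpha> \<beta> \<gamma>"
        if "Poly_Mapping.single n (1 :: 'k) \<in> ?G" "\<And>v. Poly_Mapping.lookup n v \<le> Poly_Mapping.lookup m v" for n
      proof -
        have "Poly_Mapping.single m k = Poly_Mapping.single (m - n) k * Poly_Mapping.single n 1"
          using exponent_le_imp_add[OF that(2)] by (simp add: mult_single)
        then show ?thesis using I.I_l_closed[OF gen[OF that(1)], of "Poly_Mapping.single (m - n) k"] by simp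
      qed
      have "?P m" using update by (simp add: keys_update)
      then have "Poly_Mapping.single m k \<in> I_ideal a b c \<alpha> \<beta> \<gamma>"
        unfolding in_monomial_ideal_def
      proof (elim disjE)
        assume "a \<le> Poly_Mapping.lookup m Vx"
        then show ?thesis
          by (intro single[of "Poly_Mapping.single Vx a"]) (auto simp: var_power_def lookup_single when_def)
      next
        assume "b \<le> Poly_Mapping.lookup m Vy"
        then show ?thesis
          by (intro single[of "Poly_Mapping.single Vy b"]) (auto simp: var_power_def lookup_single when_def)
      next
        assume "c \<le> Poly_Mapping.lookup m Vz"
        then show ?thesis
          by (intro single[of "Poly_Mapping.single Vz c"]) (auto simp: var_power_def lookup_single when_def)
      next
        assume "\<alpha> \<le> Poly_Mapping.lookup m Vx \<and> \<beta> \<le> Poly_Mapping.lookup m Vy \<and> \<gamma> \<le> Poly_Mapping.lookup m Vz"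
        then show ?thesis
          by (intro single[of "Poly_Mapping.single Vx \<alpha> + Poly_Mapping.single Vy \<beta> + Poly_Mapping.single Vz \<gamma>"])
             (auto simp: var_power_def mult_single lookup_add lookup_single when_def)
      qed
      moreover have "f \<in> I_ideal a b c \<alpha> \<beta> \<gamma>"
        using update by (auto simp: keys_update)
      ultimately show ?case
        using I.a_closed update(1) by (simp add: update_eq_add_single)
    }
  qed
  ultimately show ?thesis by blast
qed

lemma lookup_single_mult_add:
  fixes f :: "'k::field poly3"
  shows "Poly_Mapping.lookup (Poly_Mapping.single t k * f) (t + s) = k * Poly_Mapping.lookup f s"
  by (simp add: lookup_mult lookup_single when_mult)

lemma lookup_single_mult_not_add:
  fixes f :: "'k::field poly3"
  assumes "\<And>s. m \<noteq> t + s"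
  shows "Poly_Mapping.lookup (Poly_Mapping.single t k * f) m = 0"
  using assms by (simp add: lookup_mult lookup_single when_mult)

definition exponent :: "nat \<Rightarrow> nat \<Rightarrow> nat \<Rightarrow> variable \<Rightarrow>\<^sub>0 nat" where
  "exponent i j k = Poly_Mapping.single Vx i + Poly_Mapping.single Vy j + Poly_Mapping.single Vz k"

lemma lookup_exponent [simp]:
  "Poly_Mapping.lookup (exponent i j k) Vx = i"
  "Poly_Mapping.lookup (exponent i j k) Vy = j"
  "Poly_Mapping.lookup (exponent i j k) Vz = k"
  by (simp_all add: exponent_def lookup_add lookup_single when_def)

lemma exponent_cases: obtains i j k where "m = exponent i j k"
proof
  show "m = exponent (Poly_Mapping.lookup m Vx) (Poly_Mapping.lookup m Vy) (Poly_Mapping.lookup m Vz)"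
    by (rule poly_mapping_eqI) (metis lookup_exponent variable.exhaust)
qed

lemma exponent_add: "exponent i j k + exponent i' j' k' = exponent (i + i') (j + j') (k + k')"
  by (rule poly_mapping_eqI) (metis lookup_exponent lookup_add variable.exhaust)

lemma monomial_degree_exponent [simp]: "monomial_degree (exponent i j k) = i + j + k"
  by (simp add: monomial_degree_def)

text \<open>Exponents are integers here, and negative ones give zero. Multiplication by a monomial then is a shift of the
coefficients without any boundary cases.\<close>

definition coefficient :: "'k::field poly3 \<Rightarrow> int \<Rightarrow> int \<Rightarrow> int \<Rightarrow> 'k" where
  "coefficient f i j k =
     (if i < 0 \<or> j < 0 \<or> k < 0 then 0 else Poly_Mapping.lookup f (exponent (nat i) (nat j) (nat k)))"

lemma coefficient_add: "coefficient (f + g) i j k = coefficient f i j k + coefficient g i j k"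
  by (simp add: coefficient_def lookup_add)

lemma coefficient_monomial_mult:
  "coefficient (Poly_Mapping.single (exponent u v w) 1 * f) i j k =
     coefficient f (i - int u) (j - int v) (k - int w)"
proof (cases "i < int u \<or> j < int v \<or> k < int w")
  case True
  have "exponent (nat i) (nat j) (nat k) \<noteq> exponent u v w + s" if "i \<ge> 0" "j \<ge> 0" "k \<ge> 0" for s
  proof
    obtain u' v' w' where s: "s = exponent u' v' w'" by (rule exponent_cases)
    assume "exponent (nat i) (nat j) (nat k) = exponent u v w + s"
    then have "exponent (nat i) (nat j) (nat k) = exponent (u + u') (v + v') (w + w')"
      by (simp add: s exponent_add)
    then have "nat i = u + u'" "nat j = v + v'" "nat k = w + w'"
      by (metis lookup_exponent)+
    then show False using True that by linarith
  qed
  then show ?thesis using True by (auto simp: coefficient_def lookup_single_mult_not_add)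
next
  case False
  then have "exponent (nat i) (nat j) (nat k) =
    exponent u v w + exponent (nat (i - int u)) (nat (j - int v)) (nat (k - int w))"
    by (simp add: exponent_add nat_diff_distrib' le_nat_iff)
  then show ?thesis using False by (simp add: coefficient_def lookup_single_mult_add)
qed

definition X\<^sub>x :: "'k::field poly3" where "X\<^sub>x = Poly_Mapping.single (exponent 1 0 0) 1"
definition X\<^sub>y :: "'k::field poly3" where "X\<^sub>y = Poly_Mapping.single (exponent 0 1 0) 1"
definition X\<^sub>z :: "'k::field poly3" where "X\<^sub>z = Poly_Mapping.single (exponent 0 0 1) 1"

lemma monomial_eq_power:
  "(Poly_Mapping.single (exponent i j k) 1 :: 'k::field poly3) = X\<^sub>x ^ i * X\<^sub>y ^ j * X\<^sub>z ^ k"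
proof -
  have "(X\<^sub>x :: 'k poly3) ^ i = Poly_Mapping.single (exponent i 0 0) 1" for i
    by (induction i) (simp_all add: X\<^sub>x_def mult_single exponent_add, simp add: exponent_def)
  moreover have "(X\<^sub>y :: 'k poly3) ^ j = Poly_Mapping.single (exponent 0 j 0) 1" for j
    by (induction j) (simp_all add: X\<^sub>y_def mult_single exponent_add, simp add: exponent_def)
  moreover have "(X\<^sub>z :: 'k poly3) ^ k = Poly_Mapping.single (exponent 0 0 k) 1" for k
    by (induction k) (simp_all add: X\<^sub>z_def mult_single exponent_add, simp add: exponent_def)
  ultimately show ?thesis by (simp add: mult_single exponent_add)
qed

lemma coefficient_linear_mult:
  "coefficient ((X\<^sub>x + X\<^sub>y + X\<^sub>z) * f) i j k =
     coefficient f (i - 1) j k + coefficient f i (j - 1) k + coefficient f i j (k - 1)"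
  by (simp add: distrib_right coefficient_add X\<^sub>x_def X\<^sub>y_def X\<^sub>z_def coefficient_monomial_mult)

lemma forms_coefficient_nonzero:
  assumes "f \<in> forms d" "coefficient f i j k \<noteq> 0"
  shows "0 \<le> i" "0 \<le> j" "0 \<le> k" "i + j + k = d"
proof -
  show nn: "0 \<le> i" "0 \<le> j" "0 \<le> k" using assms(2) by (auto simp: coefficient_def split: if_splits)
  then have "exponent (nat i) (nat j) (nat k) \<in> Poly_Mapping.keys f"
    using assms(2) by (auto simp: coefficient_def in_keys_iff)
  then show "i + j + k = d" using assms(1) nn by (fastforce simp: forms_def)
qed

lemma single_exponent_in_forms: "Poly_Mapping.single (exponent i j k) r \<in> forms (int (i + j + k))"
  by (simp add: forms_def)

lemma power_product_in_forms: "X\<^sub>x ^ i * X\<^sub>y ^ j * X\<^sub>z ^ k \<in> forms (int (i + j + k))"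
  unfolding monomial_eq_power[symmetric] by (rule single_exponent_in_forms)

lemma const_in_forms: "Poly_Mapping.single 0 r \<in> forms 0"
  by (simp add: forms_def monomial_degree_def)

lemma of_int_in_forms: "of_int n \<in> forms 0"
  using const_in_forms[of "of_int n"] by simp

lemma linear_in_forms: "X\<^sub>x \<in> forms 1" "X\<^sub>y \<in> forms 1" "X\<^sub>z \<in> forms 1"
  by (simp_all add: forms_def X\<^sub>x_def X\<^sub>y_def X\<^sub>z_def)

lemma I_ideal_iff_coefficient:
  "f \<in> I_ideal a b c \<alpha> \<beta> \<gamma> \<longleftrightarrow>
     (\<forall>i j k. i < int a \<longrightarrow> j < int b \<longrightarrow> k < int c \<longrightarrow> \<not> (int \<alpha> \<le> i \<and> int \<beta> \<le> j \<and> int \<gamma> \<le> k) \<longrightarrow>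
        coefficient f i j k = 0)" (is "_ \<longleftrightarrow> ?R")
proof
  assume f: "f \<in> I_ideal a b c \<alpha> \<beta> \<gamma>"
  show ?R
  proof (intro allI impI)
    fix i j k assume good: "i < int a" "j < int b" "k < int c" "\<not> (int \<alpha> \<le> i \<and> int \<beta> \<le> j \<and> int \<gamma> \<le> k)"
    have "exponent (nat i) (nat j) (nat k) \<notin> Poly_Mapping.keys f" if "i \<ge> 0" "j \<ge> 0" "k \<ge> 0"
    proof
      assume "exponent (nat i) (nat j) (nat k) \<in> Poly_Mapping.keys f"
      then have "in_monomial_ideal a b c \<alpha> \<beta> \<gamma> (exponent (nat i) (nat j) (nat k))"
        using f by (simp add: I_ideal_eq)
      then show False using good that by (auto simp: in_monomial_ideal_def)
    qed
    then show "coefficient f i j k = 0"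
      by (auto simp: coefficient_def in_keys_iff)
  qed
next
  assume R: ?R
  have "in_monomial_ideal a b c \<alpha> \<beta> \<gamma> m" if m: "m \<in> Poly_Mapping.keys f" for m
  proof (rule ccontr)
    obtain i j k where m': "m = exponent i j k" by (rule exponent_cases)
    assume "\<not> in_monomial_ideal a b c \<alpha> \<beta> \<gamma> m"
    then have "coefficient f (int i) (int j) (int k) = 0"
      using R by (intro R[rule_format]) (auto simp: in_monomial_ideal_def m')
    then show False using m by (simp add: coefficient_def m' in_keys_iff)
  qed
  then show "f \<in> I_ideal a b c \<alpha> \<beta> \<gamma>" by (simp add: I_ideal_eq)
qed

lemma ideal_I_ideal: "ideal (I_ideal a b c \<alpha> \<beta> \<gamma>) poly3_ring"
  unfolding I_ideal_def by (rule poly3.genideal_ideal) simp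

lemma I_ideal_add: "f \<in> I_ideal a b c \<alpha> \<beta> \<gamma> \<Longrightarrow> g \<in> I_ideal a b c \<alpha> \<beta> \<gamma> \<Longrightarrow> f + g \<in> I_ideal a b c \<alpha> \<beta> \<gamma>"
  by (simp add: I_ideal_iff_coefficient coefficient_add)

lemma I_ideal_mult: "f \<in> I_ideal a b c \<alpha> \<beta> \<gamma> \<Longrightarrow> g * f \<in> I_ideal a b c \<alpha> \<beta> \<gamma>"
  using ideal.I_l_closed[OF ideal_I_ideal, of f a b c \<alpha> \<beta> \<gamma> g] by simp

lemma I_ideal_0: "0 \<in> I_ideal a b c \<alpha> \<beta> \<gamma>"
  by (simp add: I_ideal_iff_coefficient coefficient_def)

lemma power_product_in_I_ideal_iff:
  "X\<^sub>x ^ i * X\<^sub>y ^ j * X\<^sub>z ^ k \<in> (I_ideal a b c \<alpha> \<beta> \<gamma> :: 'k::field poly3 set) \<longleftrightarrow>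
     a \<le> i \<or> b \<le> j \<or> c \<le> k \<or> (\<alpha> \<le> i \<and> \<beta> \<le> j \<and> \<gamma> \<le> k)"
  unfolding monomial_eq_power[symmetric] by (simp add: I_ideal_eq in_monomial_ideal_def)

section \<open>Injectivity up to the peak\<close>

lemma adjugate_entries:
  fixes g :: "nat \<Rightarrow> nat \<Rightarrow> int"
  obtains R where
    "\<And>i j. i < n \<Longrightarrow> j < n \<Longrightarrow> (\<Sum>k<n. g i k * R k j) = (if i = j then det (mat n n (\<lambda>(i, j). g i j)) else 0)"
    "\<And>i j. i < n \<Longrightarrow> j < n \<Longrightarrow> (\<Sum>k<n. R i k * g k j) = (if i = j then det (mat n n (\<lambda>(i, j). g i j)) else 0)"
proof -
  define G where "G = mat n n (\<lambda>(i, j). g i j)"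
  have G: "G \<in> carrier_mat n n" by (simp add: G_def)
  have adj: "(\<Sum>k<n. g i k * adj_mat G $$ (k, j)) = (if i = j then det G else 0)"
            "(\<Sum>k<n. adj_mat G $$ (i, k) * g k j) = (if i = j then det G else 0)"
    if "i < n" "j < n" for i j
    using arg_cong[OF adj_mat(2)[OF G], of "\<lambda>U. U $$ (i, j)"] arg_cong[OF adj_mat(3)[OF G], of "\<lambda>U. U $$ (i, j)"]
      that adj_mat(1)[OF G] by (simp_all add: G_def scalar_prod_def atLeast0LessThan)
  show ?thesis using that[of "\<lambda>i j. adj_mat G $$ (i, j)"] adj unfolding G_def by blast
qed

text \<open>The left-hand side is a convolution with a row of Pascal's triangle, the right-hand side a column of the
matrix \<open>N\<close> (without its unit rows) applied to the values of \<open>g\<close>.\<close>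

lemma binomial_transform_reindex:
  fixes g :: "int \<Rightarrow> 'k::field"
  assumes "\<And>v. v < 0 \<or> int C \<le> v \<Longrightarrow> g v = 0"
  shows "(\<Sum>r\<le>c. of_nat (c choose r) * g (int J - int r)) =
         (\<Sum>k<C. of_int (int (if k \<le> J then c choose (J - k) else 0)) * g (int k))"
proof -
  have "(\<Sum>r\<le>c. of_nat (c choose r) * g (int J - int r)) =
        (\<Sum>r | r \<le> c \<and> r \<le> J \<and> J - r < C. of_nat (c choose r) * g (int J - int r))"
    by (rule sum.mono_neutral_right) (auto intro!: assms)
  also have "\<dots> = (\<Sum>k | k < C \<and> k \<le> J \<and> J - k \<le> c. of_nat (c choose (J - k)) * g (int k))"
    by (rule sum.reindex_bij_witness[of _ "\<lambda>k. J - k" "\<lambda>r. J - r"]) auto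
  also have "\<dots> = (\<Sum>k<C. of_int (int (if k \<le> J then c choose (J - k) else 0)) * g (int k))"
    by (rule sum.mono_neutral_cong_left) (auto, metis binomial_eq_0 not_le of_nat_0)
  finally show ?thesis .
qed

text \<open>The image of multiplication by \<open>l\<close> is pulled back from the quotient to the polynomial ring, where its closure
properties are plain ring arithmetic.\<close>

definition image_forms :: "'k::field poly3 set \<Rightarrow> 'k poly3 \<Rightarrow> int \<Rightarrow> 'k poly3 set" where
  "image_forms I l d = {g \<in> forms d. \<exists>f\<in>forms (d - 1). g - l * f \<in> I}"

text \<open>The number \<open>e\<close> is the degree \<open>s + 1\<close> of the target of the bijective multiplication map. Column \<open>j\<close> of \<open>N\<close>
belongs to the monomial \<open>x\<^bsup>a-1-j\<^esup> y\<^bsup>A+j\<^esup>\<close> of this degree, and row \<open>i < q + p\<close> to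
\<open>x\<^bsup>q+p-1-i\<^esup> y\<^sup>i (x + y)\<^sup>c\<close>.\<close>

locale almost_complete_intersection =
  fixes A B M p q a b c \<alpha> \<beta> e :: nat and N :: "nat \<Rightarrow> nat \<Rightarrow> int" and I :: "'k::field poly3 set" and l :: "'k poly3"
  assumes a: "a = M + B + q + p" and b: "b = M + A + q + p" and c: "c = M + A + B"
    and \<alpha>: "\<alpha> = B + p" and \<beta>: "\<beta> = A + q" and c_pos: "0 < c"
    and e: "e = M + A + B + q + p - 1"
    and N: "N = (\<lambda>i j. if i < q + p then int (if i \<le> A + j then c choose (A + j - i) else 0)
                     else if j + p = i then 1 else 0)"
    and I: "I = I_ideal a b c \<alpha> \<beta> 0" and l: "l = X\<^sub>x + X\<^sub>y + X\<^sub>z"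
    and det_nz: "of_int (det (mat (q + p + M) (q + p + M) (\<lambda>(i, j). N i j))) \<noteq> (0 :: 'k)"
begin

text \<open>These are the exponents of the monomials in \<open>x\<close> and \<open>y\<close> that survive in \<open>T\<close>. Negative exponents are admitted,
which makes the predicate stable under lowering an exponent.\<close>

definition good :: "int \<Rightarrow> int \<Rightarrow> bool" where
  "good i j \<longleftrightarrow> i < int a \<and> j < int b \<and> \<not> (int \<alpha> \<le> i \<and> int \<beta> \<le> j)"

lemma in_I_iff: "f \<in> I \<longleftrightarrow> (\<forall>i j k. good i j \<longrightarrow> k < int c \<longrightarrow> coefficient f i j k = 0)"
proof -
  have "coefficient f i j k = 0" if "\<not> 0 \<le> k" for i j k using that by (simp add: coefficient_def)
  then show ?thesis unfolding I I_ideal_iff_coefficient good_def by (metis of_nat_0)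
qed

lemma good_pred: "good i j \<Longrightarrow> good (i - 1) j \<and> good i (j - 1)"
  by (auto simp: good_def)

text \<open>Write \<open>f\<close> as a polynomial in \<open>z\<close> with coefficients \<open>f\<^sub>k\<close> in \<open>K[x,y]\<close>. The vanishing of \<open>(x + y + z) f\<close> means
\<open>f\<^bsub>k-1\<^esub> = -(x + y) f\<^sub>k\<close> modulo the relations of \<open>T\<close>, so \<open>f\<^sub>k\<close> for \<open>k = c - 1 - t\<close> is \<open>(-1)\<^sup>t (x + y)\<^sup>t\<close> times the top
coefficient. The case \<open>t = c\<close> says that \<open>(x + y)\<^sup>c\<close> kills the top coefficient.\<close>

lemma coefficients_of_kernel_element:
  assumes lf: "l * f \<in> I" and "t \<le> c" "good i j"
  shows "coefficient f i j (int c - 1 - int t) =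
    (-1) ^ t * (\<Sum>r\<le>t. of_nat (t choose r) * coefficient f (i - (int t - int r)) (j - int r) (int c - 1))"
  using assms(2,3)
proof (induction t arbitrary: i j)
  case (Suc t)
  let ?F = "\<lambda>i j. coefficient f i j (int c - 1)"
  have "coefficient f (i - 1) j (int c - 1 - int t) + coefficient f i (j - 1) (int c - 1 - int t) +
        coefficient f i j (int c - 1 - int t - 1) = 0"
  proof -
    have "coefficient (l * f) i j (int c - 1 - int t) = 0"
      using lf Suc.prems unfolding in_I_iff by simp
    then show ?thesis by (simp add: l coefficient_linear_mult)
  qed
  then have "coefficient f i j (int c - 1 - int (Suc t)) =
    - (coefficient f (i - 1) j (int c - 1 - int t) + coefficient f i (j - 1) (int c - 1 - int t))"
    by (simp add: algebra_simps eq_neg_iff_add_eq_0)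
  also have "\<dots> = (-1) ^ Suc t *
      ((\<Sum>r\<le>t. of_nat (t choose r) * ?F (i - 1 - (int t - int r)) (j - int r)) +
       (\<Sum>r\<le>t. of_nat (t choose r) * ?F (i - (int t - int r)) (j - 1 - int r)))"
    using Suc.IH[of "i - 1" j] Suc.IH[of i "j - 1"] Suc.prems good_pred[of i j]
    by (simp add: algebra_simps)
  also have "(\<Sum>r\<le>t. of_nat (t choose r) * ?F (i - 1 - (int t - int r)) (j - int r)) +
       (\<Sum>r\<le>t. of_nat (t choose r) * ?F (i - (int t - int r)) (j - 1 - int r)) =
     (\<Sum>r\<le>Suc t. of_nat (Suc t choose r) * ?F (i - (int (Suc t) - int r)) (j - int r))"
  proof -
    let ?G = "\<lambda>r. ?F (i - (int (Suc t) - int r)) (j - int r)"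
    have "(\<Sum>r\<le>t. of_nat (t choose r) * ?F (i - 1 - (int t - int r)) (j - int r)) = (\<Sum>r\<le>Suc t. of_nat (t choose r) * ?G r)"
      by (simp add: binomial_eq_0 algebra_simps)
    also have "\<dots> = ?G 0 + (\<Sum>r\<le>t. of_nat (t choose Suc r) * ?G (Suc r))"
      by (subst sum.atMost_Suc_shift) simp
    finally have 1: "(\<Sum>r\<le>t. of_nat (t choose r) * ?F (i - 1 - (int t - int r)) (j - int r)) = \<dots>" .
    have 2: "(\<Sum>r\<le>t. of_nat (t choose r) * ?F (i - (int t - int r)) (j - 1 - int r)) =
      (\<Sum>r\<le>t. of_nat (t choose r) * ?G (Suc r))"
      by (rule sum.cong) (simp_all add: algebra_simps)
    have "(\<Sum>r\<le>Suc t. of_nat (Suc t choose r) * ?G r) =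
      ?G 0 + (\<Sum>r\<le>t. of_nat (Suc t choose Suc r) * ?G (Suc r))"
      by (subst sum.atMost_Suc_shift) simp
    also have "(\<Sum>r\<le>t. of_nat (Suc t choose Suc r) * ?G (Suc r)) =
      (\<Sum>r\<le>t. of_nat (t choose Suc r) * ?G (Suc r)) + (\<Sum>r\<le>t. of_nat (t choose r) * ?G (Suc r))"
      unfolding sum.distrib[symmetric] by (rule sum.cong) (simp_all add: distrib_right)
    finally show ?thesis unfolding 1 2 by (simp add: add.assoc)
  qed
  finally show ?case .
qed simp

text \<open>The coefficients of the top coefficient \<open>f\<^bsub>c-1\<^esub>\<close>, a form of degree \<open>C - 1\<close> in \<open>x\<close> and \<open>y\<close>, are annihilated by the
columns of \<open>N\<close> that have no unit entry. They extend to a vector annihilated by all columns, which must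
vanish; and \<open>f\<^bsub>c-1\<^esub>\<close> determines \<open>f\<close> modulo \<open>I\<close>.\<close>

lemma kernel_peak:
  assumes f: "f \<in> forms (int e - 1)" and lf: "l * f \<in> I"
  shows "f \<in> I"
proof -
  let ?C = "q + p" and ?n = "q + p + M"
  have e': "int e = int M + int A + int B + int q + int p - 1" using c_pos unfolding e c by (subst of_nat_diff) auto
  define g where "g v = coefficient f (int ?C - 1 - v) v (int c - 1)" for v
  have g0: "g v = 0" if "v < 0 \<or> int ?C \<le> v" for v
    using that by (auto simp: g_def coefficient_def)
  have gN: "(\<Sum>k<?C. of_int (N k j) * g (int k)) = 0" if j: "j < q \<or> q + M \<le> j" "j < ?n" for j
  proof -
    let ?i = "int a - 1 - int j" and ?j = "int A + int j"
    have "good ?i ?j" using j unfolding good_def by (auto simp: a b \<alpha> \<beta>)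
    then have "coefficient f ?i ?j (int c - 1 - int c) =
      (-1) ^ c * (\<Sum>r\<le>c. of_nat (c choose r) * coefficient f (?i - (int c - int r)) (?j - int r) (int c - 1))"
      by (intro coefficients_of_kernel_element[OF lf]) auto
    moreover have "coefficient f ?i ?j (int c - 1 - int c) = 0" by (simp add: coefficient_def)
    moreover have "?i - (int c - int r) = int ?C - 1 - (?j - int r)" for r by (simp add: a c)
    ultimately have sum0: "(\<Sum>r\<le>c. of_nat (c choose r) * g (int (A + j) - int r)) = 0"
      by (simp add: g_def)
    have "(\<Sum>k<?C. of_int (N k j) * g (int k)) =
      (\<Sum>k<?C. of_int (int (if k \<le> A + j then c choose (A + j - k) else 0)) * g (int k))"
      by (rule sum.cong) (simp_all add: N)
    also have "\<dots> = 0"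
      using sum0 binomial_transform_reindex[where g = g and C = "q + p" and J = "A + j" and c = c, OF g0] by simp
    finally show ?thesis .
  qed
  \<comment> \<open>the entries at the unit rows are forced: column \<open>k - p\<close> has its one in row \<open>k\<close>\<close>
  define u where "u k = (if k < ?C then g (int k) else - (\<Sum>i<?C. of_int (N i (k - p)) * g (int i)))" for k
  have uN: "(\<Sum>k<?n. u k * of_int (N k j)) = 0" if j: "j < ?n" for j
  proof -
    have "(\<Sum>k<?n. u k * of_int (N k j)) =
      (\<Sum>k<?C. u k * of_int (N k j)) + (\<Sum>m<M. u (?C + m) * of_int (N (?C + m) j))"
      by (induction M) (simp_all add: add.assoc)
    also have "(\<Sum>k<?C. u k * of_int (N k j)) = (\<Sum>k<?C. of_int (N k j) * g (int k))"
      by (rule sum.cong) (auto simp: u_def)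
    also have "(\<Sum>m<M. u (?C + m) * of_int (N (?C + m) j)) = (\<Sum>m<M. if m = j - q \<and> q \<le> j then u (j + p) else 0)"
      by (rule sum.cong) (auto simp: N intro!: arg_cong[where f = u])
    also have "\<dots> = (if q \<le> j \<and> j < q + M then u (j + p) else 0)"
      by (auto simp: sum.delta)
    finally show ?thesis using gN[of j] j by (auto simp: u_def)
  qed
  obtain R where R: "\<And>i j. i < ?n \<Longrightarrow> j < ?n \<Longrightarrow>
    (\<Sum>k<?n. N i k * R k j) = (if i = j then det (mat ?n ?n (\<lambda>(i, j). N i j)) else 0)"
    by (rule adjugate_entries[of ?n N]) blast
  have u0: "u k = 0" if k: "k < ?n" for k
  proof -
    let ?d = "det (mat ?n ?n (\<lambda>(i, j). N i j))"
    have "0 = (\<Sum>j<?n. (\<Sum>i<?n. u i * of_int (N i j)) * of_int (R j k))"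
      by (simp add: uN)
    also have "\<dots> = (\<Sum>i<?n. \<Sum>j<?n. u i * of_int (N i j) * of_int (R j k))"
      unfolding sum_distrib_right by (rule sum.swap)
    also have "\<dots> = (\<Sum>i<?n. u i * of_int (\<Sum>j<?n. N i j * R j k))"
      by (simp add: sum_distrib_left mult.assoc)
    also have "\<dots> = (\<Sum>i<?n. if i = k then u k * of_int ?d else 0)"
      using k by (intro sum.cong) (auto simp: R)
    also have "\<dots> = u k * of_int ?d" using k by simp
    finally show ?thesis using det_nz by simp
  qed
  have g_zero: "g v = 0" for v
  proof (cases "v < 0 \<or> int ?C \<le> v")
    case False
    then have "nat v < ?C" "int (nat v) = v" by auto
    then show ?thesis using u0[of "nat v"] by (simp add: u_def)
  qed (rule g0)
  have top: "coefficient f i j (int c - 1) = 0" for i j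
  proof (rule ccontr)
    assume nz: "coefficient f i j (int c - 1) \<noteq> 0"
    then have "i + j + (int c - 1) = int e - 1" by (rule forms_coefficient_nonzero(4)[OF f])
    then have "i = int ?C - 1 - j" by (simp add: e' c)
    then show False using nz g_zero[of j] by (simp add: g_def)
  qed
  show ?thesis unfolding in_I_iff
  proof (intro allI impI)
    fix i j k assume good: "good i j" and k: "k < int c"
    show "coefficient f i j k = 0"
    proof (cases "k \<ge> 0")
      case True
      then have "k = int c - 1 - int (c - 1 - nat k)" using k by simp
      then show ?thesis
        using coefficients_of_kernel_element[OF lf _ good, of "c - 1 - nat k"] by (simp add: top)
    qed (simp add: coefficient_def)
  qed
qed

text \<open>If \<open>f\<close> is in the kernel, so are its multiples by the variables, which lie in \<open>I\<close> by induction; thus \<open>f\<close> is a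
socle element of the quotient. But the socle lives in the degrees \<open>\<alpha> + b + c - 3\<close> and \<open>a + \<beta> + c - 3\<close>, which
are at least \<open>e - 1\<close>.\<close>

lemma kernel_below_peak:
  assumes "f \<in> forms (int e - 1 - int n)" and "l * f \<in> I"
  shows "f \<in> I"
  using assms
proof (induction n arbitrary: f)
  case 0
  then show ?case by (simp add: kernel_peak)
next
  case (Suc n)
  have e': "int e = int M + int A + int B + int q + int p - 1" using c_pos unfolding e c by (subst of_nat_diff) auto
  have step: "v * f \<in> I" if v: "v \<in> forms 1" for v
  proof (rule Suc.IH)
    show "v * f \<in> forms (int e - 1 - int n)"
      using forms_mult[OF v Suc.prems(1)] by (simp add: algebra_simps)
    show "l * (v * f) \<in> I"
      using I_ideal_mult[of "l * f" a b c \<alpha> \<beta> 0 v] Suc.prems(2) by (simp add: I mult_ac)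
  qed
  have shift: "coefficient (X\<^sub>x * f) i j k = coefficient f (i - 1) j k"
    "coefficient (X\<^sub>y * f) i j k = coefficient f i (j - 1) k"
    "coefficient (X\<^sub>z * f) i j k = coefficient f i j (k - 1)" for i j k
    by (simp_all add: X\<^sub>x_def X\<^sub>y_def X\<^sub>z_def coefficient_monomial_mult)
  show ?case unfolding in_I_iff
  proof (intro allI impI, rule ccontr)
    fix i j k assume good: "good i j" "k < int c" and nz: "coefficient f i j k \<noteq> 0"
    note nn = forms_coefficient_nonzero[OF Suc.prems(1) nz]
    have "coefficient (X\<^sub>x * f) (i + 1) j k \<noteq> 0" "coefficient (X\<^sub>y * f) i (j + 1) k \<noteq> 0"
      "coefficient (X\<^sub>z * f) i j (k + 1) \<noteq> 0" using nz by (simp_all add: shift)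
    then have "\<not> good (i + 1) j" "\<not> good i (j + 1)" "\<not> k + 1 < int c"
      using step[OF linear_in_forms(1)] step[OF linear_in_forms(2)] step[OF linear_in_forms(3)] good
      unfolding in_I_iff by blast+
    then show False using good nn e' unfolding good_def unfolding a b c \<alpha> \<beta> by auto
  qed
qed

end

section \<open>Surjectivity from the peak on\<close>

context almost_complete_intersection
begin

abbreviation "S \<equiv> image_forms I l"

lemma l_in_forms: "l \<in> forms 1"
  unfolding l by (intro forms_add linear_in_forms)

lemma ideal_in_image_forms: "g \<in> I \<Longrightarrow> g \<in> forms d \<Longrightarrow> g \<in> S d"
  by (auto simp: image_forms_def intro!: bexI[of _ 0] forms_0)

lemma multiple_in_image_forms: "f \<in> forms (d - 1) \<Longrightarrow> l * f \<in> S d"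
  using forms_mult[OF l_in_forms, of f "d - 1"]
  by (auto simp: image_forms_def I I_ideal_0 intro!: bexI[of _ f])

lemma image_forms_add: "g \<in> S d \<Longrightarrow> h \<in> S d \<Longrightarrow> g + h \<in> S d"
proof -
  assume "g \<in> S d" "h \<in> S d"
  then obtain u v where *: "g \<in> forms d" "h \<in> forms d" "u \<in> forms (d - 1)" "g - l * u \<in> I"
    "v \<in> forms (d - 1)" "h - l * v \<in> I" by (auto simp: image_forms_def)
  have "g + h - l * (u + v) \<in> I"
    using I_ideal_add[of "g - l * u" a b c \<alpha> \<beta> 0 "h - l * v"] * by (simp add: I algebra_simps)
  then show ?thesis using * by (auto simp: image_forms_def forms_add intro!: bexI[of _ "u + v"])
qed

lemma image_forms_mult: "g \<in> S d \<Longrightarrow> h \<in> forms d' \<Longrightarrow> h * g \<in> S (d' + d)"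
proof -
  assume "g \<in> S d" and h: "h \<in> forms d'"
  then obtain u where *: "g \<in> forms d" "u \<in> forms (d - 1)" "g - l * u \<in> I" by (auto simp: image_forms_def)
  have "h * g - l * (h * u) \<in> I"
    using I_ideal_mult[of "g - l * u" a b c \<alpha> \<beta> 0 h] * by (simp add: I algebra_simps)
  moreover have "h * u \<in> forms (d' + d - 1)" using forms_mult[OF h *(2)] by (simp add: add_diff_eq)
  ultimately show ?thesis using * h by (auto simp: image_forms_def forms_mult intro!: bexI[of _ "h * u"])
qed

lemma image_forms_uminus: "g \<in> S d \<Longrightarrow> - g \<in> S d"
  using image_forms_mult[of g d "of_int (-1)" 0, OF _ of_int_in_forms] by simp

lemma image_forms_diff: "g \<in> S d \<Longrightarrow> h \<in> S d \<Longrightarrow> g - h \<in> S d"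
  using image_forms_add[of g d "- h"] image_forms_uminus[of h d] by simp

lemma image_forms_sum: "(\<And>i. i \<in> T \<Longrightarrow> f i \<in> S d) \<Longrightarrow> (\<Sum>i\<in>T. f i) \<in> S d"
  by (induction T rule: infinite_finite_induct)
     (auto simp: image_forms_add intro!: ideal_in_image_forms forms_0, auto simp: I I_ideal_0)

text \<open>Replacing factors \<open>x + y\<close> by \<open>l - z\<close> one at a time leads from \<open>(x + y)\<^sup>c\<close> to \<open>\<plusminus>z\<^sup>c\<close>, which is in the ideal.\<close>

lemma linear_power_in_image_forms:
  assumes m: "m \<in> forms d"
  shows "m * (X\<^sub>x + X\<^sub>y) ^ c \<in> S (d + int c)"
proof -
  let ?w = "X\<^sub>x + X\<^sub>y :: 'k poly3"
  have w: "?w \<in> forms 1" by (intro forms_add linear_in_forms)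
  have pw: "v ^ n \<in> forms (int n)" if "v \<in> forms 1" for v :: "'k poly3" and n
  proof (induction n)
    case 0
    show ?case using of_int_in_forms[of 1] by simp
  next
    case (Suc n)
    then show ?case using forms_mult[OF that Suc.IH] by (simp add: add.commute)
  qed
  have "m * ?w ^ u * X\<^sub>z ^ (c - u) \<in> S (d + int c)" if "u \<le> c" for u
    using that
  proof (induction u)
    case 0
    have "X\<^sub>z ^ c \<in> I" using power_product_in_I_ideal_iff[of 0 0 c, where 'k = 'k] by (simp add: I)
    then have "m * X\<^sub>z ^ c \<in> I" by (simp add: I I_ideal_mult)
    moreover have "m * X\<^sub>z ^ c \<in> forms (d + int c)" by (intro forms_mult m pw linear_in_forms)
    ultimately show ?case by (simp add: ideal_in_image_forms)
  next
    case (Suc u)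
    let ?h = "m * ?w ^ u * X\<^sub>z ^ (c - Suc u)"
    have "?h \<in> forms (d + int u + int (c - Suc u))" by (intro forms_mult m pw linear_in_forms w)
    also have "d + int u + int (c - Suc u) = d + int c - 1" using Suc.prems by simp
    finally have "l * ?h \<in> S (d + int c)" by (rule multiple_in_image_forms)
    moreover have "m * ?w ^ u * X\<^sub>z ^ (c - u) \<in> S (d + int c)" using Suc by simp
    moreover have "c - u = Suc (c - Suc u)" using Suc.prems by simp
    then have "m * ?w ^ Suc u * X\<^sub>z ^ (c - Suc u) = l * ?h - m * ?w ^ u * X\<^sub>z ^ (c - u)"
      by (simp add: l algebra_simps)
    ultimately show ?case by (simp only: image_forms_diff)
  qed
  from this[of c] show ?thesis by simp
qed

text \<open>The rows of \<open>N\<close> give forms in the image: expansions of multiples of \<open>(x + y)\<^sup>c\<close>, up to multiples of \<open>x\<^sup>a\<close> or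
\<open>y\<^sup>b\<close>, and multiples of \<open>x\<^sup>\<alpha> y\<^sup>\<beta>\<close>. Since \<open>N\<close> is invertible over the field, the single monomials are in
the image as well.\<close>

lemma binary_monomials_in_image_forms:
  assumes "i + j = e"
  shows "X\<^sub>x ^ i * X\<^sub>y ^ j \<in> S (int e)"
proof -
  let ?C = "q + p" and ?n = "q + p + M"
  have e1: "e + 1 = M + A + B + q + p" using c_pos by (simp add: e c)
  define mono where "mono v = (X\<^sub>x ^ (e - v) * X\<^sub>y ^ v :: 'k poly3)" for v
  have mono_forms: "mono v \<in> forms (int e)" if "v \<le> e" for v
    using power_product_in_forms[of "e - v" v 0] that by (simp add: mono_def)
  have mono_I: "mono v \<in> I \<longleftrightarrow> a \<le> e - v \<or> b \<le> v \<or> (\<alpha> \<le> e - v \<and> \<beta> \<le> v)" for v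
    using power_product_in_I_ideal_iff[of "e - v" v 0, where 'k = 'k] c_pos by (simp add: mono_def I)
  \<comment> \<open>among the monomials of degree \<open>e\<close>, those that belong to no column are multiples of \<open>x\<^sup>a\<close> or \<open>y\<^sup>b\<close>\<close>
  have outside: "mono v \<in> S (int e)" if "v \<le> e" "v < A \<or> A + ?n \<le> v" for v
  proof (rule ideal_in_image_forms[OF _ mono_forms[OF that(1)]])
    show "mono v \<in> I" unfolding mono_I using that e1 by (auto simp: a b)
  qed
  have rows: "(\<Sum>j<?n. of_int (N k j) * mono (A + j)) \<in> S (int e)" if k: "k < ?n" for k
  proof (cases "k < ?C")
    case True
    define h where "h v = of_nat (if k \<le> v then c choose (v - k) else 0) * mono v" for v
    have "X\<^sub>x ^ (?C - 1 - k) * X\<^sub>y ^ k * (X\<^sub>x + X\<^sub>y) ^ c \<in> S (int (?C - 1 - k + k) + int c)"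
      using power_product_in_forms[of "?C - 1 - k" k 0] by (intro linear_power_in_image_forms) simp
    also have "int (?C - 1 - k + k) + int c = int e" using True e1 by (simp add: c)
    also have "X\<^sub>x ^ (?C - 1 - k) * X\<^sub>y ^ k * (X\<^sub>x + X\<^sub>y) ^ c = (\<Sum>r\<le>c. h (k + r))"
    proof -
      have "(X\<^sub>x + X\<^sub>y) ^ c = (\<Sum>r\<le>c. of_nat (c choose r) * X\<^sub>y ^ r * X\<^sub>x ^ (c - r) :: 'k poly3)"
        unfolding add.commute[of "X\<^sub>x"] by (rule binomial_ring)
      moreover have "X\<^sub>x ^ (?C - 1 - k) * X\<^sub>y ^ k * (of_nat (c choose r) * X\<^sub>y ^ r * X\<^sub>x ^ (c - r)) = h (k + r)"
        if "r \<le> c" for r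
      proof -
        have "e - (k + r) = (?C - 1 - k) + (c - r)" using True that e1 by (simp add: c)
        then show ?thesis by (simp add: h_def mono_def power_add mult_ac)
      qed
      ultimately show ?thesis by (simp add: sum_distrib_left)
    qed
    also have "\<dots> = (\<Sum>v\<in>{k..k + c}. h v)"
      by (rule sum.reindex_bij_witness[of _ "\<lambda>v. v - k" "\<lambda>r. k + r"]) auto
    also have "\<dots> = (\<Sum>v\<le>e. h v)"
      using True e1 by (intro sum.mono_neutral_left) (auto simp: h_def binomial_eq_0 c)
    also have "\<dots> = (\<Sum>v\<in>{A..<A + ?n}. h v) + (\<Sum>v\<in>{..e} - {A..<A + ?n}. h v)"
      using e1 by (subst add.commute, intro sum.subset_diff) auto
    finally have "(\<Sum>v\<in>{A..<A + ?n}. h v) + (\<Sum>v\<in>{..e} - {A..<A + ?n}. h v) \<in> S (int e)" .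
    moreover have "(\<Sum>v\<in>{..e} - {A..<A + ?n}. h v) \<in> S (int e)"
    proof (rule image_forms_sum)
      fix v assume "v \<in> {..e} - {A..<A + ?n}"
      then have "mono v \<in> S (int e)" by (intro outside) auto
      then show "h v \<in> S (int e)"
        using image_forms_mult[OF _ of_int_in_forms, of "mono v" "int e" "int (if k \<le> v then c choose (v - k) else 0)"]
        by (simp add: h_def)
    qed
    ultimately have "(\<Sum>v\<in>{A..<A + ?n}. h v) \<in> S (int e)" using image_forms_diff by fastforce
    also have "(\<Sum>v\<in>{A..<A + ?n}. h v) = (\<Sum>j<?n. h (A + j))"
      by (rule sum.reindex_bij_witness[of _ "\<lambda>j. A + j" "\<lambda>v. v - A"]) auto
    also have "\<dots> = (\<Sum>j<?n. of_int (N k j) * mono (A + j))"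
      using True by (simp add: h_def N)
    finally show ?thesis .
  next
    case False
    \<comment> \<open>a unit row picks out a single monomial, a multiple of \<open>x\<^sup>\<alpha> y\<^sup>\<beta>\<close>\<close>
    have "(\<Sum>j<?n. of_int (N k j) * mono (A + j)) = (\<Sum>j<?n. if j = k - p then mono (A + j) else 0)"
      using False by (intro sum.cong) (auto simp: N)
    also have "\<dots> = mono (A + (k - p))" using k False by simp
    also have "\<dots> \<in> S (int e)"
    proof (rule ideal_in_image_forms)
      show "mono (A + (k - p)) \<in> I" unfolding mono_I using k False e1 by (auto simp: \<alpha> \<beta>)
      show "mono (A + (k - p)) \<in> forms (int e)" using k False e1 by (intro mono_forms) simp
    qed
    finally show ?thesis .
  qed
  obtain R where R: "\<And>i j. i < ?n \<Longrightarrow> j < ?n \<Longrightarrow>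
    (\<Sum>k<?n. R i k * N k j) = (if i = j then det (mat ?n ?n (\<lambda>(i, j). N i j)) else 0)"
    by (rule adjugate_entries[of ?n N]) blast
  have inside: "mono (A + i) \<in> S (int e)" if i: "i < ?n" for i
  proof -
    let ?d = "det (mat ?n ?n (\<lambda>(i, j). N i j))"
    have "(\<Sum>k<?n. of_int (R i k) * (\<Sum>j<?n. of_int (N k j) * mono (A + j))) \<in> S (int e)"
      using image_forms_mult[OF rows of_int_in_forms] by (intro image_forms_sum) simp
    also have "(\<Sum>k<?n. of_int (R i k) * (\<Sum>j<?n. of_int (N k j) * mono (A + j))) =
      (\<Sum>j<?n. \<Sum>k<?n. of_int (R i k) * (of_int (N k j) * mono (A + j)))"
      unfolding sum_distrib_left by (rule sum.swap)
    also have "\<dots> = (\<Sum>j<?n. of_int (\<Sum>k<?n. R i k * N k j) * mono (A + j))"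
      by (simp add: sum_distrib_right mult.assoc)
    also have "\<dots> = (\<Sum>j<?n. if j = i then of_int ?d * mono (A + i) else 0)"
      using i by (intro sum.cong) (auto simp: R)
    also have "\<dots> = of_int ?d * mono (A + i)" using i by simp
    finally have "Poly_Mapping.single 0 (inverse (of_int ?d)) * (of_int ?d * mono (A + i)) \<in> S (int e)"
      using image_forms_mult[OF _ const_in_forms] by fastforce
    moreover have "Poly_Mapping.single 0 (inverse (of_int ?d)) * (of_int ?d :: 'k poly3) = 1"
      using det_nz by (simp add: mult_single flip: single_of_int single_one)
    ultimately show ?thesis by (simp flip: mult.assoc)
  qed
  have "mono j \<in> S (int e)"
  proof (cases "j < A \<or> A + ?n \<le> j")
    case True
    then show ?thesis using outside[of j] assms by simp
  next
    case False
    then have "j - A < ?n" "A + (j - A) = j" by auto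
    then show ?thesis using inside[of "j - A"] by simp
  qed
  moreover have "e - j = i" using assms by simp
  ultimately show ?thesis by (simp add: mono_def)
qed

text \<open>Modulo \<open>l\<close> a factor \<open>z\<close> can be traded for \<open>-(x + y)\<close>.\<close>

lemma monomials_peak_in_image_forms:
  assumes "i + j + k = e"
  shows "X\<^sub>x ^ i * X\<^sub>y ^ j * X\<^sub>z ^ k \<in> S (int e)"
  using assms
proof (induction k arbitrary: i j)
  case 0
  then show ?case using binary_monomials_in_image_forms[of i j] by simp
next
  case (Suc k)
  have "int (i + j + k) = int e - 1" using Suc.prems by linarith
  then have "l * (X\<^sub>x ^ i * X\<^sub>y ^ j * X\<^sub>z ^ k) \<in> S (int e)"
    using power_product_in_forms[of i j k] by (intro multiple_in_image_forms) simp
  moreover have "X\<^sub>x ^ Suc i * X\<^sub>y ^ j * X\<^sub>z ^ k \<in> S (int e)" "X\<^sub>x ^ i * X\<^sub>y ^ Suc j * X\<^sub>z ^ k \<in> S (int e)"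
    using Suc.IH[of "Suc i" j] Suc.IH[of i "Suc j"] Suc.prems by simp_all
  ultimately have "l * (X\<^sub>x ^ i * X\<^sub>y ^ j * X\<^sub>z ^ k) - X\<^sub>x ^ Suc i * X\<^sub>y ^ j * X\<^sub>z ^ k
      - X\<^sub>x ^ i * X\<^sub>y ^ Suc j * X\<^sub>z ^ k \<in> S (int e)"
    by (intro image_forms_diff)
  also have "l * (X\<^sub>x ^ i * X\<^sub>y ^ j * X\<^sub>z ^ k) - X\<^sub>x ^ Suc i * X\<^sub>y ^ j * X\<^sub>z ^ k
      - X\<^sub>x ^ i * X\<^sub>y ^ Suc j * X\<^sub>z ^ k = X\<^sub>x ^ i * X\<^sub>y ^ j * X\<^sub>z ^ Suc k"
    by (simp add: l algebra_simps)
  finally show ?case .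
qed

lemma monomials_above_peak_in_image_forms:
  assumes "i + j + k = e + n"
  shows "X\<^sub>x ^ i * X\<^sub>y ^ j * X\<^sub>z ^ k \<in> S (int (e + n))"
  using assms
proof (induction n arbitrary: i j k)
  case 0
  then show ?case using monomials_peak_in_image_forms[of i j k] by simp
next
  case (Suc n)
  have mult: "v * m \<in> S (int (e + Suc n))" if "v \<in> forms 1" "m \<in> S (int (e + n))" for v m
    using image_forms_mult[OF that(2,1)] by (simp add: add.commute add.left_commute)
  consider i' where "i = Suc i'" | j' where "j = Suc j'" | k' where "k = Suc k'"
    using Suc.prems by (cases i; cases j; cases k) auto
  then show ?case
  proof cases
    case 1
    then show ?thesis using mult[OF linear_in_forms(1) Suc.IH[of i' j k]] Suc.prems by (simp add: mult_ac)
  next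
    case 2
    then show ?thesis using mult[OF linear_in_forms(2) Suc.IH[of i j' k]] Suc.prems by (simp add: mult_ac)
  next
    case 3
    then show ?thesis using mult[OF linear_in_forms(3) Suc.IH[of i j k']] Suc.prems by (simp add: mult_ac)
  qed
qed

lemma forms_subset_image_forms:
  assumes "g \<in> forms (int (e + n))"
  shows "g \<in> S (int (e + n))"
  using assms
proof (induction g rule: update_induct)
  case const
  show ?case by (intro ideal_in_image_forms) (auto simp: I I_ideal_0 forms_0)
next
  case (update f m r)
  obtain i j k where m: "m = exponent i j k" by (rule exponent_cases)
  have "i + j + k = e + n" "f \<in> forms (int (e + n))"
    using update by (auto simp: forms_def keys_update m simp flip: of_nat_add)
  moreover have "Poly_Mapping.single m r = Poly_Mapping.single 0 r * (X\<^sub>x ^ i * X\<^sub>y ^ j * X\<^sub>z ^ k)"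
    by (simp add: m mult_single flip: monomial_eq_power)
  ultimately have "Poly_Mapping.single m r \<in> S (int (e + n))"
    using image_forms_mult[OF monomials_above_peak_in_image_forms[of i j k n] const_in_forms[of r]] by simp
  then show ?case
    using update.IH \<open>f \<in> forms (int (e + n))\<close> update.hyps(1)
    by (simp add: update_eq_add_single image_forms_add)
qed

lemma weak_Lefschetz: "quotient_has_WLP I"
proof (rule quotient_has_WLPI[of I l])
  show "ideal I poly3_ring" unfolding I by (rule ideal_I_ideal)
  show "l \<in> forms 1" by (rule l_in_forms)
  fix d :: int
  show "(\<forall>f\<in>forms d. l * f \<in> I \<longrightarrow> f \<in> I) \<or> (\<forall>g\<in>forms (d + 1). \<exists>f\<in>forms d. g - l * f \<in> I)"
  proof (cases "d < int e")
    case True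
    then have "d = int e - 1 - int (nat (int e - 1 - d))" by simp
    then show ?thesis using kernel_below_peak[of _ "nat (int e - 1 - d)"] by metis
  next
    case False
    then have "d + 1 = int (e + nat (d + 1 - int e))" by simp
    then have "g \<in> S (d + 1)" if "g \<in> forms (d + 1)" for g
      using forms_subset_image_forms[of g] that by metis
    then show ?thesis by (auto simp: image_forms_def)
  qed
qed

end

section \<open>The determinant formula and the weak Lefschetz property\<close>

theorem proposition6p12:
  fixes a b c \<alpha> \<beta> \<gamma> s A B C M :: int
  assumes "0 \<le> \<alpha>" "\<alpha> < a" and "0 \<le> \<beta>" "\<beta> < b" and "0 \<le> \<gamma>" "\<gamma> < c"
    and "\<not> (\<alpha> = 0 \<and> \<beta> = 0)" "\<not> (\<alpha> = 0 \<and> \<gamma> = 0)" "\<not> (\<beta> = 0 \<and> \<gamma> = 0)"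
    and "(a + b + c + \<alpha> + \<beta> + \<gamma>) mod 3 = 0"
    and "s = (a + b + c + \<alpha> + \<beta> + \<gamma>) div 3 - 2"
    and "A = s + 2 - a" and "B = s + 2 - b" and "C = s + 2 - c"
    and "M = s + 2 - (\<alpha> + \<beta> + \<gamma>)"
    and "0 \<le> M"
    and "0 \<le> A" "A \<le> \<beta> + \<gamma>"
    and "0 \<le> B" "B \<le> \<alpha> + \<gamma>"
    and "0 \<le> C" "C \<le> \<alpha> + \<beta>"
    and "\<gamma> = 0"
  shows "(real_of_int \<bar>det (N_matrix a b c \<alpha> \<beta> \<gamma>)\<bar> =
           Mac (nat (\<beta> - A)) (nat A) (nat M) * Mac (nat (\<alpha> - B)) (nat B) (nat M) *
           (real (hyperfactorial (nat (A + M)) * hyperfactorial (nat (B + M)) *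
                  hyperfactorial (nat (C + M)) * hyperfactorial (nat (A + B + C + M))) /
            real (hyperfactorial (nat a) * hyperfactorial (nat b) *
                  hyperfactorial (nat c) * hyperfactorial (nat M)))) \<and>
         (infinite (UNIV :: 'k::field set) \<and> (CHAR('k) = 0 \<or> int CHAR('k) \<ge> A + B + C + M) \<longrightarrow>
         quotient_has_WLP
           (I_ideal (nat a) (nat b) (nat c) (nat \<alpha>) (nat \<beta>) (nat \<gamma>) :: 'k poly3 set))"
proof -
  define A' B' M' p q where "A' = nat A" "B' = nat B" "M' = nat M" "p = nat (\<alpha> - B)" "q = nat (\<beta> - A)"
  note defs = this
  have sum: "a + b + c + \<alpha> + \<beta> = 3 * (s + 2)"
    using assms(10,11,23) by presburger
  have nat_eqs: "A = int A'" "B = int B'" "M = int M'" "\<alpha> = int (B' + p)" "\<beta> = int (A' + q)"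
    unfolding defs using assms(16-20,23) by simp_all
  have "s + 2 = M + \<alpha> + \<beta>" using assms(15,23) by simp
  moreover from this have "C = int (q + p)" using sum assms(12-14) nat_eqs by simp
  ultimately have eqs: "a = int (M' + B' + q + p)" "b = int (M' + A' + q + p)" "c = int (M' + A' + B')"
    "C = int (q + p)"
    using assms(12-14) nat_eqs by simp_all
  have "quotient_has_WLP (I_ideal (M' + B' + q + p) (M' + A' + q + p) (M' + A' + B') (B' + p) (A' + q) 0 :: 'k poly3 set)"
    if "CHAR('k) = 0 \<or> A' + B' + (q + p) + M' \<le> CHAR('k)"
  proof -
    define N where "N = (\<lambda>i j. if i < q + p then int (if i \<le> A' + j then (M' + A' + B') choose (A' + j - i) else 0)
                     else if j + p = i then 1 else 0)"
    interpret almost_complete_intersection A' B' M' p q "M' + B' + q + p" "M' + A' + q + p" "M' + A' + B'" "B' + p" "A' + q"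
      "M' + A' + B' + q + p - 1" N
      "I_ideal (M' + B' + q + p) (M' + A' + q + p) (M' + A' + B') (B' + p) (A' + q) 0 :: 'k poly3 set"
      "X\<^sub>x + X\<^sub>y + X\<^sub>z"
    proof
      show "0 < M' + A' + B'" using assms(5,6) unfolding eqs(3) by linarith
      show "of_int (det (mat (q + p + M') (q + p + M') (\<lambda>(i, j). N i j))) \<noteq> (0 :: 'k)"
        using det_N_matrix_nonzero[of M' A' B' q p, where 'k = 'k] that unfolding N_matrix_gamma_0 N_def
        by (simp add: add_ac)
    qed (simp_all add: N_def)
    show ?thesis by (rule weak_Lefschetz)
  qed
  moreover have "nat (int (x + y) - int x) = y" for x y by simp
  ultimately show ?thesis
    using abs_det_N_matrix_Mac[of M' B' q p A'] unfolding eqs nat_eqs \<open>\<gamma> = 0\<close>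
    by (simp flip: of_nat_add)
qed

end
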